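(* Let $\Theta\subseteq\mathbb{R}^k$, $\Lambda\subseteq\mathbb{R}^\ell$, and for each $\lambda\in\Lambda$ let $\Pi(\cdot|\lambda)$ be a prior on $\Theta$ with density $\pi(\cdot|\lambda)$ with respect to Lebesgue measure. Let $\hat\lambda_n$ be the maximum marginal likelihood estimator and $\hat m(X_{1:n})=m(X_{1:n}|\hat\lambda_n)$, where $m(X_{1:n}|\lambda)=\int_\Theta p_\theta^{(n)}(X_{1:n})\,\mathrm{d}\Pi(\theta|\lambda)$. Suppose that the true value $\theta_0\in\Theta$ satisfies $\sup_{\lambda\in\Lambda}\pi(\theta_0|\lambda)=\infty$. Assume: (A1) there exist constants $c_1,c_2>0$ such that, for any $\epsilon>0$, $P_0^*\bigl(\sup_{\theta\in U_\epsilon^c}R(p_\theta^{(n)})\ge e^{-c_1n\epsilon^2}\bigr)\le c_2(n\epsilon^2)^{-(1+t)}$ for all $n$, for some $t>0$, where $P_0^*$ denotes the outer measure of $P_0^\infty$; (i) there exists $\lambda_0\in\bar\Lambda$ such that $\Pi(\cdot|\lambda_0)=\delta_{\theta_0}$; (ii) with $P_{\theta_0}^{(n)}$-probability going to $1$, $\hat m(X_{1:n})\ge p_{\theta_0}^{(n)}(X_{1:n})$; (iii) the model admits a LAN expansion in the following form: for each $\epsilon>0$ there exists a set, with $P_{\theta_0}^{(n)}$-probability going to $1$, on which, uniformly in $\theta\in U_\epsilon$, $$-\frac{n(\theta-\hat\theta_n)'I(\theta_0)(\theta-\hat\theta_n)}{2}(1+\epsilon)\le l_n(\theta)-l_n(\hat\theta_n)\le-\frac{n(\theta-\hat\theta_n)'I(\theta_0)(\theta-\hat\theta_n)}{2}(1-\epsilon),$$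 where $\hat\theta_n$ denotes the maximum likelihood estimator; (iv) $2\,[\,l_n(\hat\theta_n)-l_n(\theta_0)]$ converges in distribution (under $P_{\theta_0}^{(n)}$) to a $\chi^2$-distribution with $k$ degrees of freedom. Then the empirical Bayes posterior cannot merge strongly with any Bayes posterior $\Pi(\cdot|\lambda,X_{1:n})$ with $\lambda\in\Lambda$ such that the prior density $\pi(\cdot|\lambda)$ is positive and continuous at $\theta_0$; that is, for every such $\lambda$, it is not the case that the total variation distance between $\Pi(\cdot|\hat\lambda_n,X_{1:n})$ and $\Pi(\cdot|\lambda,X_{1:n})$ tends to $0$ $P_0^\infty$-almost surely.
   Context: $\mathcal{X}$ (observations) is a complete separable metric space, and so is $\Theta$; $(X_i)_{i\ge1}$ is a sequence of $\mathcal{X}$-valued random elements whose law is modeled by a family $\{P_\theta^\infty:\theta\in\Theta\}$ (not necessarily i.i.d.). $X_{1:n}=(X_1,\ldots,X_n)$ has law $P_\theta^{(n)}$ with density $p_\theta^{(n)}$ with respect to a common $\sigma$-finite measure (possibly depending on $n$). $\theta_0$ is the true value and $P_0^\infty=P_{\theta_0}^\infty$. $l_n(\theta)=\log p_\theta^{(n)}(X_{1:n})$ is the log-likelihood and $R(p_\theta^{(n)})=p_\theta^{(n)}(X_{1:n})/p_{\theta_0}^{(n)}(X_{1:n})$ the likelihood ratio. $I(\theta_0)$ is the $k\times k$ (positive definite) Fisher information matrix at $\theta_0$. $d$ is a semi-metric on $\Theta$ and $U_\epsilon=\{\theta\in\Theta:d(\theta,\theta_0)<\epsilon\}$. The maximum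 marginal likelihood estimator is $\hat\lambda_n\in\operatorname{argmax}_{\lambda\in\Lambda}m(X_{1:n}|\lambda)$. It may take values in the closure $\bar\Lambda$ of $\Lambda$; for $\lambda$ in the boundary of $\Lambda$, $\Pi(\cdot|\lambda)$ is defined as the weak limit of the priors at values in $\Lambda$ tending to $\lambda$, when it exists (so it may be a Dirac mass). In all cases $\hat m(X_{1:n})=\sup_{\lambda\in\Lambda}m(X_{1:n}|\lambda)$, assumed finite for all large $n$, $P_\theta^\infty$-a.s., for all $\theta$. The posterior for $\lambda$ is $\Pi(B|\lambda,X_{1:n})=\int_Bp_\theta^{(n)}(X_{1:n})\,\mathrm{d}\Pi(\theta|\lambda)/m(X_{1:n}|\lambda)$, and the empirical Bayes posterior is $\Pi(\cdot|\hat\lambda_n,X_{1:n})$, assumed well defined, i.e. a probability measure for all large $n$, $P_\theta^\infty$-a.s., for all $\theta$. $\delta_{\theta_0}$ is the Dirac mass at $\theta_0$. (Frequentist) strong merging of two posteriors means that their total variation distance tends to $0$, $P_0^\infty$-almost surely. The usual measurability is assumed. *)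

theory Defs
  imports "HOL-Probability.Probability"
begin

text \<open>
  The model is given on the canonical space: \<open>P \<theta>\<close> is the law of the whole observation sequence,
  a probability measure on the product space \<open>seq_space\<close>, and the observations are the coordinates.
  Coordinates are numbered from 0, so that the first \<open>n\<close> observations are indexed by \<open>{..<n}\<close>.
\<close>

abbreviation seq_space :: "(nat \<Rightarrow> 'x::polish_space) measure" where
  "seq_space \<equiv> PiM UNIV (\<lambda>_. borel)"

abbreviation sample_space :: "nat \<Rightarrow> (nat \<Rightarrow> 'x::polish_space) measure" where
  "sample_space n \<equiv> PiM {..<n} (\<lambda>_. borel)"

definition obs :: "nat \<Rightarrow> (nat \<Rightarrow> 'x) \<Rightarrow> (nat \<Rightarrow> 'x)" where
  "obs n \<omega> = restrict \<omega> {..<n}"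

definition sample_law :: "(nat \<Rightarrow> 'x::polish_space) measure \<Rightarrow> nat \<Rightarrow> (nat \<Rightarrow> 'x) measure" where
  "sample_law Q n = distr Q (sample_space n) (obs n)"

text \<open>
  \<open>p n \<theta> x\<close> is the density of the law of the first \<open>n\<close> observations under \<open>\<theta>\<close>. The log-likelihood
  is extended-real-valued because \<open>ln 0 = 0\<close> in the reals, while \<open>log 0\<close> has to be \<open>-\<infinity>\<close>.
\<close>

definition log_lik ::
  "(nat \<Rightarrow> 'p \<Rightarrow> (nat \<Rightarrow> 'x) \<Rightarrow> real) \<Rightarrow> nat \<Rightarrow> 'p \<Rightarrow> (nat \<Rightarrow> 'x) \<Rightarrow> ereal" where
  "log_lik p n \<theta> x = (if p n \<theta> x = 0 then - \<infinity> else ereal (ln (p n \<theta> x)))"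

definition lik_ratio ::
  "(nat \<Rightarrow> 'p \<Rightarrow> (nat \<Rightarrow> 'x) \<Rightarrow> real) \<Rightarrow> nat \<Rightarrow> 'p \<Rightarrow> 'p \<Rightarrow> (nat \<Rightarrow> 'x) \<Rightarrow> ennreal" where
  "lik_ratio p n \<theta>0 \<theta> x = ennreal (p n \<theta> x) / ennreal (p n \<theta>0 x)"

definition is_mle ::
  "'p set \<Rightarrow> (nat \<Rightarrow> 'p \<Rightarrow> (nat \<Rightarrow> 'x) \<Rightarrow> real) \<Rightarrow> nat \<Rightarrow> (nat \<Rightarrow> 'x) \<Rightarrow> 'p \<Rightarrow> bool" where
  "is_mle \<Theta> p n x t \<longleftrightarrow> t \<in> \<Theta> \<and> (\<forall>\<theta>\<in>\<Theta>. p n \<theta> x \<le> p n t x)"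

text \<open>
  The term semi-metric is used in the literature both for pseudo-metrics (triangle inequality, but
  distinct points may have distance 0) and for symmetric functions that separate points but need
  not satisfy the triangle inequality. Only the properties common to both readings are required.
\<close>

definition semimetric_on :: "'p set \<Rightarrow> ('p \<Rightarrow> 'p \<Rightarrow> real) \<Rightarrow> bool" where
  "semimetric_on \<Theta> d \<longleftrightarrow> (\<forall>x\<in>\<Theta>. \<forall>y\<in>\<Theta>. 0 \<le> d x y \<and> d x y = d y x \<and> d x x = 0)"

definition nbhd :: "'p set \<Rightarrow> ('p \<Rightarrow> 'p \<Rightarrow> real) \<Rightarrow> 'p \<Rightarrow> real \<Rightarrow> 'p set" where
  "nbhd \<Theta> d \<theta>0 \<epsilon> = {\<theta>\<in>\<Theta>. d \<theta> \<theta>0 < \<epsilon>}"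

definition positive_definite :: "real^'k^'k \<Rightarrow> bool" where
  "positive_definite A \<longleftrightarrow> transpose A = A \<and> (\<forall>v. v \<noteq> 0 \<longrightarrow> 0 < v \<bullet> (A *v v))"

subsection \<open>Priors and posteriors\<close>

definition prior_of_density ::
  "'p::euclidean_space set \<Rightarrow> ('p \<Rightarrow> real) \<Rightarrow> 'p measure" where
  "prior_of_density \<Theta> f = density (restrict_space lborel \<Theta>) (\<lambda>\<theta>. ennreal (f \<theta>))"

definition weak_limit_measure ::
  "'p::topological_space set \<Rightarrow> 'i filter \<Rightarrow> ('i \<Rightarrow> 'p measure) \<Rightarrow> 'p measure \<Rightarrow> bool" where
  "weak_limit_measure \<Theta> F M Q \<longleftrightarrow>
     sets Q = sets (restrict_space borel \<Theta>) \<and> prob_space Q \<and>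
     (\<forall>f::'p \<Rightarrow> real. continuous_on \<Theta> f \<and> bounded (f ` \<Theta>) \<longrightarrow>
        ((\<lambda>i. \<integral>\<theta>. f \<theta> \<partial>M i) \<longlongrightarrow> (\<integral>\<theta>. f \<theta> \<partial>Q)) F)"

text \<open>
  The prior at a hyperparameter in the closure of \<open>\<Lambda>\<close>: the given one on \<open>\<Lambda>\<close>, and otherwise the
  weak limit of the given ones along \<open>\<Lambda>\<close>. The limit is unique if it exists; if it does not
  exist, the prior is undefined, represented by the zero measure (which never yields a posterior
  that is a probability measure).
\<close>

definition prior ::
  "'p::euclidean_space set \<Rightarrow> 'h::topological_space set \<Rightarrow> ('h \<Rightarrow> 'p \<Rightarrow> real) \<Rightarrow> 'h \<Rightarrow> 'p measure" where
  "prior \<Theta> \<Lambda> \<pi> l =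
     (let lim = weak_limit_measure \<Theta> (at l within \<Lambda>) (\<lambda>l'. prior_of_density \<Theta> (\<pi> l')) in
      if l \<in> \<Lambda> then prior_of_density \<Theta> (\<pi> l)
      else if (\<exists>Q. lim Q) then (SOME Q. lim Q)
      else null_measure (restrict_space borel \<Theta>))"

definition marg_lik ::
  "'p measure \<Rightarrow> (nat \<Rightarrow> 'p \<Rightarrow> (nat \<Rightarrow> 'x) \<Rightarrow> real) \<Rightarrow> nat \<Rightarrow> (nat \<Rightarrow> 'x) \<Rightarrow> ennreal" where
  "marg_lik \<mu> p n x = (\<integral>\<^sup>+\<theta>. ennreal (p n \<theta> x) \<partial>\<mu>)"

definition max_marg_lik ::
  "'h set \<Rightarrow> ('h \<Rightarrow> 'p measure) \<Rightarrow> (nat \<Rightarrow> 'p \<Rightarrow> (nat \<Rightarrow> 'x) \<Rightarrow> real) \<Rightarrow> nat \<Rightarrow> (nat \<Rightarrow> 'x) \<Rightarrow> ennreal" where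
  "max_marg_lik \<Lambda> \<mu> p n x = (SUP l\<in>\<Lambda>. marg_lik (\<mu> l) p n x)"

definition is_mmle ::
  "'h::topological_space set \<Rightarrow> ('h \<Rightarrow> 'p measure) \<Rightarrow> (nat \<Rightarrow> 'p \<Rightarrow> (nat \<Rightarrow> 'x) \<Rightarrow> real)
     \<Rightarrow> nat \<Rightarrow> (nat \<Rightarrow> 'x) \<Rightarrow> 'h \<Rightarrow> bool" where
  "is_mmle \<Lambda> \<mu> p n x l \<longleftrightarrow> l \<in> closure \<Lambda> \<and> marg_lik (\<mu> l) p n x = max_marg_lik \<Lambda> \<mu> p n x"

definition posterior ::
  "'p measure \<Rightarrow> (nat \<Rightarrow> 'p \<Rightarrow> (nat \<Rightarrow> 'x) \<Rightarrow> real) \<Rightarrow> nat \<Rightarrow> (nat \<Rightarrow> 'x) \<Rightarrow> 'p measure" where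
  "posterior \<mu> p n x = density \<mu> (\<lambda>\<theta>. ennreal (p n \<theta> x) / marg_lik \<mu> p n x)"

subsection \<open>Modes of convergence\<close>

definition tv_dist :: "'a measure \<Rightarrow> 'a measure \<Rightarrow> real" where
  "tv_dist M N = (SUP A\<in>sets M. \<bar>measure M A - measure N A\<bar>)"

definition merge_strongly ::
  "'w measure \<Rightarrow> (nat \<Rightarrow> 'w \<Rightarrow> 'a measure) \<Rightarrow> (nat \<Rightarrow> 'w \<Rightarrow> 'a measure) \<Rightarrow> bool" where
  "merge_strongly P M N \<longleftrightarrow> (AE \<omega> in P. (\<lambda>n. tv_dist (M n \<omega>) (N n \<omega>)) \<longlonglongrightarrow> 0)"

text \<open>
  The event where \<open>A n\<close> holds is not required to be measurable; it has to contain measurable sets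
  whose probabilities tend to 1.
\<close>

definition with_prob_tending_to_1 :: "(nat \<Rightarrow> 'a measure) \<Rightarrow> (nat \<Rightarrow> 'a \<Rightarrow> bool) \<Rightarrow> bool" where
  "with_prob_tending_to_1 M A \<longleftrightarrow>
     (\<exists>S. (\<forall>n. S n \<in> sets (M n) \<and> (\<forall>x\<in>S n. A n x)) \<and> (\<lambda>n. measure (M n) (S n)) \<longlonglongrightarrow> 1)"

definition chi_square_density :: "nat \<Rightarrow> real \<Rightarrow> real" where
  "chi_square_density k x =
     (if x \<le> 0 then 0
      else x powr (real k / 2 - 1) * exp (- x / 2) / (2 powr (real k / 2) * Gamma (real k / 2)))"

definition chi_square :: "nat \<Rightarrow> real measure" where
  "chi_square k = density lborel (\<lambda>x. ennreal (chi_square_density k x))"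

end

theory Submission
  imports Defs
begin

text \<open>
  Suppose that the two posteriors merge, and let \<open>V r\<close> be the \<open>\<pi>\<close>-mass of the part of a fixed
  neighbourhood \<open>U\<close> of \<open>\<theta>0\<close> within Euclidean distance \<open>r\<close> of \<open>\<theta>0\<close>. Since the marginal likelihood
  of the empirical Bayes prior is at least the likelihood at \<open>\<theta>0\<close>, the empirical Bayes posterior puts
  little mass where the likelihood ratio is small. By merging, so does the Bayes posterior, and hence the
  Bayes marginal likelihood is at most a constant times the likelihood at \<open>\<theta>0\<close> times
  \<open>V (r0 / sqrt n)\<close>. Conversely, the inverse likelihood ratio \<open>p n \<theta>0 x / p n \<theta> x\<close> has integral at
  most 1 under the empirical Bayes posterior, so merging bounds its integral over a ball of radius
  \<open>R / sqrt n\<close> under the Bayes posterior, which is the likelihood at \<open>\<theta>0\<close> times \<open>V (R / sqrt n)\<close>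
  divided by the marginal likelihood. Together, \<open>V (R / sqrt n) \<le> 8 * V (r0 / sqrt n)\<close> for every fixed
  \<open>R\<close> and all large \<open>n\<close>. Iterating over scales, \<open>V r\<close> decays more slowly than any power of \<open>r\<close>,
  whereas it is at most linear in \<open>r\<close> because the prior density is bounded near \<open>\<theta>0\<close>.

  The event on which all this happens needs only probability bounded away from 0, which the
  chi-square limit of the likelihood ratio statistic provides.
\<close>

section \<open>Tools from measure theory\<close>

text \<open>A completely metrizable subspace of a metrizable space is a G-delta set. This makes the
  parameter space a Borel set, so that prior masses of its subsets can be compared with Lebesgue
  volumes.\<close>

lemma borel_of_completely_metrizable:
  fixes S :: "'a::polish_space set"
  assumes "completely_metrizable_space (top_of_set S)"
  shows "S \<in> sets borel"
proof -
  have "gdelta_in euclidean S"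
    using completely_metrizable_space_imp_gdelta_in[OF metrizable_space_euclidean, of S] assms by simp
  then obtain C where "\<And>n::nat. openin euclidean (C n)" "\<Inter>(range C) = S"
    unfolding gdelta_in_descending by blast
  then show ?thesis
    using sets.countable_INT'[of UNIV C borel] by (auto simp: image_subset_iff)
qed

text \<open>Each level between 0 and \<open>K\<close> contributes an error of at most
  \<open>\<eta>\<close>. The lemma later turns closeness of two posteriors in total variation into
  closeness of the integrals of a truncated inverse likelihood ratio.\<close>

lemma nn_integral_le_of_emeasure_le:
  fixes g :: "'a \<Rightarrow> real"
  assumes M: "sigma_finite_measure M" and N: "sigma_finite_measure N" and sets: "sets M = sets N"
    and g: "g \<in> borel_measurable M" and K: "0 \<le> K" "\<And>x. x \<in> space M \<Longrightarrow> g x \<le> K"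
    and le: "\<And>A. A \<in> sets M \<Longrightarrow> emeasure M A \<le> emeasure N A + ennreal \<eta>" and "0 \<le> \<eta>"
  shows "(\<integral>\<^sup>+x. ennreal (g x) \<partial>M) \<le> (\<integral>\<^sup>+x. ennreal (g x) \<partial>N) + ennreal (K * \<eta>)"
proof -
  \<comment> \<open>Layer cake: the hypothesis is applied to the superlevel sets of \<open>g\<close>.\<close>
  have layer: "(\<integral>\<^sup>+x. ennreal (g x) \<partial>Q) = (\<integral>\<^sup>+t. emeasure Q {x\<in>space Q. t < g x} * indicator {0..K} t \<partial>lborel)"
    if Q: "sigma_finite_measure Q" and setsQ: "sets Q = sets M" for Q
  proof -
    interpret Q: sigma_finite_measure Q by fact
    interpret pair_sigma_finite Q "lborel :: real measure" ..
    have [measurable]: "g \<in> borel_measurable Q"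
      using g setsQ by (simp cong: measurable_cong_sets)
    have "(\<integral>\<^sup>+x. ennreal (g x) \<partial>Q) = (\<integral>\<^sup>+x. \<integral>\<^sup>+t. indicator {y. 0 \<le> snd y \<and> snd y \<le> K \<and> snd y < g (fst y)} (x, t) \<partial>lborel \<partial>Q)"
    proof (intro nn_integral_cong)
      fix x assume "x \<in> space Q"
      then have "g x \<le> K" using K(2) sets_eq_imp_space_eq[OF setsQ] by auto
      \<comment> \<open>The value \<open>g x\<close> is the length of this interval; if it is
        negative, the interval is empty and \<open>ennreal\<close> gives 0 as well.\<close>
      then have "{0..<g x} = {t. 0 \<le> t \<and> t \<le> K \<and> t < g x}" by auto
      then have "(\<lambda>t. indicator {y. 0 \<le> snd y \<and> snd y \<le> K \<and> snd y < g (fst y)} (x, t) :: ennreal)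
        = indicator {0..<g x}" by (auto simp: indicator_def fun_eq_iff)
      then show "ennreal (g x) = (\<integral>\<^sup>+t. indicator {y. 0 \<le> snd y \<and> snd y \<le> K \<and> snd y < g (fst y)} (x, t) \<partial>lborel)"
        by (cases "0 \<le> g x") (simp_all add: ennreal_neg)
    qed
    also have "\<dots> = (\<integral>\<^sup>+t. \<integral>\<^sup>+x. indicator {y. 0 \<le> snd y \<and> snd y \<le> K \<and> snd y < g (fst y)} (x, t) \<partial>Q \<partial>lborel)"
      by (rule Fubini'[symmetric]) measurable
    also have "\<dots> = (\<integral>\<^sup>+t. emeasure Q {x\<in>space Q. t < g x} * indicator {0..K} t \<partial>lborel)"
    proof (intro nn_integral_cong)
      fix t :: real
      have "(\<integral>\<^sup>+x. indicator {y. 0 \<le> snd y \<and> snd y \<le> K \<and> snd y < g (fst y)} (x, t) \<partial>Q)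
        = (\<integral>\<^sup>+x. indicator {0..K} t * indicator {x\<in>space Q. t < g x} x \<partial>Q)"
        by (intro nn_integral_cong) (auto simp: indicator_def)
      also have "\<dots> = indicator {0..K} t * emeasure Q {x\<in>space Q. t < g x}"
        by (subst nn_integral_cmult_indicator) auto
      finally show "(\<integral>\<^sup>+x. indicator {y. 0 \<le> snd y \<and> snd y \<le> K \<and> snd y < g (fst y)} (x, t) \<partial>Q)
        = emeasure Q {x\<in>space Q. t < g x} * indicator {0..K} t" by (simp add: mult.commute)
    qed
    finally show ?thesis .
  qed
  note gM[measurable] = g
  have [measurable]: "g \<in> borel_measurable N"
    using g sets by (simp cong: measurable_cong_sets)
  interpret N: sigma_finite_measure N by fact
  have sp: "space M = space N" using sets by (rule sets_eq_imp_space_eq)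
  have meas[measurable]: "(\<lambda>t. emeasure N {x\<in>space N. t < g x}) \<in> borel_measurable borel"
    by measurable
  have "(\<integral>\<^sup>+x. ennreal (g x) \<partial>M) \<le> (\<integral>\<^sup>+t. emeasure N {x\<in>space N. t < g x} * indicator {0..K} t
      + ennreal \<eta> * indicator {0..K} t \<partial>lborel)"
    unfolding layer[OF M refl]
  proof (intro nn_integral_mono)
    fix t :: real
    have "emeasure M {x\<in>space M. t < g x} \<le> emeasure N {x\<in>space M. t < g x} + ennreal \<eta>"
      by (intro le) measurable
    then show "emeasure M {x\<in>space M. t < g x} * indicator {0..K} t \<le>
      emeasure N {x\<in>space N. t < g x} * indicator {0..K} t + ennreal \<eta> * indicator {0..K} t"
      by (auto simp: indicator_def sp)
  qed
  also have "\<dots> = (\<integral>\<^sup>+x. ennreal (g x) \<partial>N) + ennreal \<eta> * ennreal K"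
    unfolding layer[OF N sets[symmetric]]
    by (subst nn_integral_add) (auto simp: nn_integral_cmult K)
  finally show ?thesis using \<open>0 \<le> \<eta>\<close> K(1) by (simp add: ennreal_mult mult.commute)
qed

text \<open>
  The event \<open>Q n\<close> need not be measurable, so its probability cannot be compared with that of
  \<open>G n\<close> directly; instead the limes superior of the \<open>G n\<close> along the exceptional indices is used.
\<close>

lemma (in finite_measure) eventually_ex_of_AE_eventually:
  assumes AE: "AE \<omega> in M. \<forall>\<^sub>F n in sequentially. Q n \<omega>"
    and G: "\<And>n. n \<ge> 1 \<Longrightarrow> G n \<in> sets M" and "0 < \<rho>"
    and ge: "\<forall>\<^sub>F n in sequentially. \<rho> \<le> measure M (G n)"
  shows "\<forall>\<^sub>F n in sequentially. \<exists>\<omega>\<in>G n. Q n \<omega>"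
proof (rule ccontr)
  assume "\<not> ?thesis"
  then have bad: "\<exists>\<^sub>F n in sequentially. \<forall>\<omega>\<in>G n. \<not> Q n \<omega>"
    by (simp add: not_eventually)
  define T where "T = {n. n \<ge> 1 \<and> \<rho> \<le> measure M (G n) \<and> (\<forall>\<omega>\<in>G n. \<not> Q n \<omega>)}"
  have T: "\<exists>n\<in>T. m \<le> n" for m
  proof -
    have "\<exists>\<^sub>F n in sequentially. (max 1 m \<le> n \<and> \<rho> \<le> measure M (G n)) \<and> (\<forall>\<omega>\<in>G n. \<not> Q n \<omega>)"
      using bad ge eventually_ge_at_top[of "max 1 m"]
      by (intro frequently_eventually_conj eventually_conj)
    then show ?thesis unfolding T_def by (force dest!: frequently_ex)
  qed
  define H where "H m = (\<Union>n\<in>{n\<in>T. m \<le> n}. G n)" for m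
  have Hs: "H m \<in> sets M" for m unfolding H_def T_def by (auto intro!: G)
  have dec: "decseq H" unfolding H_def decseq_def by fastforce
  have "\<rho> \<le> measure M (H m)" for m
  proof -
    obtain n where n: "n \<in> T" "m \<le> n" using T by blast
    then have "measure M (G n) \<le> measure M (H m)"
      by (intro finite_measure_mono Hs) (auto simp: H_def)
    then show ?thesis using n by (auto simp: T_def)
  qed
  moreover have "(\<lambda>m. measure M (H m)) \<longlonglongrightarrow> measure M (\<Inter>m. H m)"
    by (intro finite_Lim_measure_decseq dec) (auto intro: Hs)
  ultimately have pos: "\<rho> \<le> measure M (\<Inter>m. H m)"
    by (intro LIMSEQ_le_const) auto
  \<comment> \<open>If \<open>Q n\<close> holds at \<omega> from index \<open>m\<close> on, then
    \<omega> lies in no \<open>G n\<close> with \<open>n\<close> in \<open>T\<close> beyond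
    \<open>m\<close>, because those sets are disjoint from \<open>Q n\<close>.\<close>
  have "AE \<omega> in M. \<omega> \<notin> (\<Inter>m. H m)"
    using AE
  proof eventually_elim
    case (elim \<omega>)
    then obtain m where "\<And>n. m \<le> n \<Longrightarrow> Q n \<omega>" unfolding eventually_sequentially by blast
    then have "\<omega> \<notin> H m" unfolding H_def T_def by auto
    then show ?case by blast
  qed
  moreover have "(\<Inter>m. H m) \<in> sets M"
    using Hs by (intro sets.countable_INT') auto
  ultimately have "emeasure M (\<Inter>m. H m) = 0"
    using AE_iff_null_sets by blast
  then show False using pos \<open>0 < \<rho>\<close> by (simp add: measure_def)
qed

section \<open>The chi-square distribution\<close>

text \<open>Replacing \<open>x\<close> by \<open>2 * x\<close> turns the density into a multiple
  \<open>c\<close> of the Gamma integrand. An upper bound on the mass is enough to speak of the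
  distribution function.\<close>

lemma chi_square_finite:
  assumes "0 < k"
  shows "finite_measure (chi_square k)"
proof -
  define c where "c = 2 powr (real k / 2 - 1) / (2 powr (real k / 2) * Gamma (real k / 2))"
  have k2: "0 < real k / 2" using assms by simp
  have Gpos: "Gamma (real k / 2) > 0" using k2 by (rule Gamma_real_pos)
  have c: "0 \<le> c" unfolding c_def using Gpos by simp
  have [measurable]: "chi_square_density k \<in> borel_measurable borel"
    unfolding chi_square_density_def by measurable
  have "(\<integral>\<^sup>+x. ennreal (chi_square_density k x) \<partial>lborel)
     = 2 * (\<integral>\<^sup>+x. ennreal (chi_square_density k (2 * x)) \<partial>lborel)"
    using nn_integral_real_affine[of "\<lambda>x. ennreal (chi_square_density k x)" 2 0] by simp
  also have "(\<integral>\<^sup>+x. ennreal (chi_square_density k (2 * x)) \<partial>lborel) \<le>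
    (\<integral>\<^sup>+x. ennreal c * ennreal (indicator {0..} x * x powr (real k / 2 - 1) / exp x) \<partial>lborel)"
  proof (intro nn_integral_mono)
    fix x :: real
    show "ennreal (chi_square_density k (2 * x)) \<le> ennreal c * ennreal (indicator {0..} x * x powr (real k / 2 - 1) / exp x)"
    proof (cases "x \<le> 0")
      case True then show ?thesis by (simp add: chi_square_density_def)
    next
      case False
      then show ?thesis using c
        by (simp add: chi_square_density_def c_def ennreal_mult'[symmetric] powr_mult exp_minus field_simps)
    qed
  qed
  also have "\<dots> = ennreal c * ennreal (Gamma (real k / 2))"
    using Gamma_conv_nn_integral_real[OF k2] by (simp add: nn_integral_cmult)
  finally have "(\<integral>\<^sup>+x. ennreal (chi_square_density k x) \<partial>lborel) \<le> 2 * (ennreal c * ennreal (Gamma (real k / 2)))"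
    by (simp add: mult_left_mono)
  also have "\<dots> < \<infinity>" by (simp add: ennreal_mult_less_top)
  finally have "emeasure (chi_square k) (space (chi_square k)) < \<infinity>"
    by (simp add: chi_square_def emeasure_density)
  then show ?thesis by (intro finite_measureI) auto
qed

text \<open>There is no atom at 1, and the density is positive on the interval from 0 to 1.
  Continuity lets weak convergence pass to the probability that the likelihood ratio statistic is at
  most 1; positivity keeps that probability away from 0.\<close>

lemma chi_square_cdf:
  assumes "0 < k"
  shows "isCont (cdf (chi_square k)) 1" and "0 < cdf (chi_square k) 1"
proof -
  have [measurable]: "chi_square_density k \<in> borel_measurable borel"
    unfolding chi_square_density_def by measurable
  interpret finite_measure "chi_square k" using chi_square_finite[OF assms] .
  interpret finite_borel_measure "chi_square k"
    by unfold_locales (simp add: chi_square_def)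
  have "emeasure (chi_square k) {1} = 0"
    by (simp add: chi_square_def emeasure_density nn_integral_null_set[of _ lborel])
  then show "isCont (cdf (chi_square k)) 1" by (simp add: isCont_cdf measure_def)
  have "measure (chi_square k) {..1} \<noteq> 0"
  proof
    assume "measure (chi_square k) {..1} = 0"
    then have "emeasure (chi_square k) {..1} = 0" by (simp add: emeasure_eq_measure)
    then have "(\<integral>\<^sup>+x. ennreal (chi_square_density k x) * indicator {..1} x \<partial>lborel) = 0"
      by (simp add: chi_square_def emeasure_density)
    then have "AE x in lborel. ennreal (chi_square_density k x) * indicator {..1} x = 0"
      by (subst (asm) nn_integral_0_iff_AE) auto
    then have "AE x::real in lborel. x \<notin> {0<..1}"
    proof eventually_elim
      case (elim x)
      show ?case
      proof
        assume x: "x \<in> {0<..1}"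
        have "0 < chi_square_density k x" using x assms Gamma_real_pos[of "real k / 2"]
          by (auto simp: chi_square_density_def)
        then show False using elim x by (simp add: indicator_def)
      qed
    qed
    then have "emeasure lborel {x\<in>space lborel. \<not> x \<notin> {0<..1::real}} = 0"
      by (subst (asm) AE_iff_measurable[OF _ refl]) auto
    moreover have "{x\<in>space lborel. \<not> x \<notin> {0<..1::real}} = {0<..1}" by auto
    ultimately show False by simp
  qed
  then show "0 < cdf (chi_square k) 1" by (simp add: cdf_def zero_less_measure_iff)
qed

section \<open>Total variation and the comparison of two posteriors\<close>

lemma measure_le_add_tv_dist:
  assumes "finite_measure M" "finite_measure N" "sets M = sets N" "A \<in> sets M"
  shows "measure N A \<le> measure M A + tv_dist M N"
proof -
  interpret M: finite_measure M by fact
  interpret N: finite_measure N by fact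
  \<comment> \<open>A real supremum dominates its members only if they are bounded above, which
    finiteness of both measures ensures.\<close>
  have "bdd_above ((\<lambda>A. \<bar>measure M A - measure N A\<bar>) ` sets M)"
  proof (intro bdd_aboveI2)
    fix B assume "B \<in> sets M"
    show "\<bar>measure M B - measure N B\<bar> \<le> measure M (space M) + measure N (space N)"
      using M.bounded_measure[of B] N.bounded_measure[of B] measure_nonneg[of M B] measure_nonneg[of N B]
      by linarith
  qed
  then have "\<bar>measure M A - measure N A\<bar> \<le> tv_dist M N"
    unfolding tv_dist_def using assms(4) by (intro cSUP_upper)
  then show ?thesis by linarith
qed

lemma emeasure_posterior:
  assumes "(\<lambda>\<theta>. p n \<theta> x) \<in> borel_measurable \<mu>" "A \<in> sets \<mu>"
  shows "emeasure (posterior \<mu> p n x) A = (\<integral>\<^sup>+\<theta>\<in>A. ennreal (p n \<theta> x) \<partial>\<mu>) / marg_lik \<mu> p n x"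
proof -
  note assms[measurable]
  have "emeasure (posterior \<mu> p n x) A = (\<integral>\<^sup>+\<theta>. ennreal (p n \<theta> x) / marg_lik \<mu> p n x * indicator A \<theta> \<partial>\<mu>)"
    unfolding posterior_def by (intro emeasure_density) measurable
  also have "\<dots> = (\<integral>\<^sup>+\<theta>. ennreal (p n \<theta> x) * indicator A \<theta> / marg_lik \<mu> p n x \<partial>\<mu>)"
    by (intro nn_integral_cong) (simp add: indicator_def)
  also have "\<dots> = (\<integral>\<^sup>+\<theta>\<in>A. ennreal (p n \<theta> x) \<partial>\<mu>) / marg_lik \<mu> p n x"
    by (intro nn_integral_divide) measurable
  finally show ?thesis .
qed

text \<open>For 0 and \<infinity> the quotient is 0 by convention. Hence a posterior has mass at
  most 1 even when its marginal likelihood is degenerate.\<close>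

lemma ennreal_divide_self_le_1: "(a::ennreal) / a \<le> 1"
  by (cases "a = 0 \<or> a = \<infinity>") (auto simp: ennreal_divide_self ennreal_divide_top top.not_eq_extremum)

lemma finite_measure_posterior:
  assumes "(\<lambda>\<theta>. p n \<theta> x) \<in> borel_measurable \<mu>"
  shows "finite_measure (posterior \<mu> p n x)"
proof (rule finite_measureI)
  have sp: "space (posterior \<mu> p n x) = space \<mu>" by (simp add: posterior_def)
  have "(\<integral>\<^sup>+\<theta>\<in>space \<mu>. ennreal (p n \<theta> x) \<partial>\<mu>) = marg_lik \<mu> p n x"
    unfolding marg_lik_def by (intro nn_integral_cong) simp
  then have "emeasure (posterior \<mu> p n x) (space \<mu>) \<le> 1"
    using assms by (subst emeasure_posterior) (auto simp: ennreal_divide_self_le_1)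
  then show "emeasure (posterior \<mu> p n x) (space (posterior \<mu> p n x)) \<noteq> \<infinity>"
    unfolding sp using ennreal_one_less_top by (metis infinity_ennreal_def leD)
qed

text \<open>
  The first conclusion, through \<open>A\<close>, bounds the marginal likelihood under \<open>N\<close> from above; integrating
  the inverse likelihood ratio over \<open>A'\<close> bounds it from below.
\<close>

lemma posterior_comparison:
  fixes M N :: "'p measure"
  assumes sets: "sets N = sets M" and M1: "emeasure M (space M) \<le> 1" and N: "prob_space N"
    and meas: "(\<lambda>\<theta>. p n \<theta> x) \<in> borel_measurable M"
    and nonneg: "\<And>\<theta>. \<theta> \<in> space M \<Longrightarrow> 0 \<le> p n \<theta> x"
    and E: "prob_space (posterior M p n x)"
    and f0: "0 < f0" "ennreal f0 \<le> marg_lik M p n x"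
    and fin: "marg_lik N p n x < \<infinity>"
    and tv: "tv_dist (posterior M p n x) (posterior N p n x) \<le> \<eta>" and \<eta>: "0 \<le> \<eta>" "\<eta> \<le> 1/4"
    and A: "A \<in> sets M" "\<And>\<theta>. \<theta> \<in> space M - A \<Longrightarrow> p n \<theta> x \<le> f0 / 4"
      "\<And>\<theta>. \<theta> \<in> A \<Longrightarrow> p n \<theta> x \<le> s * f0"
    and A': "A' \<in> sets M" "\<And>\<theta>. \<theta> \<in> A' \<Longrightarrow> f0 \<le> K * p n \<theta> x" and K: "0 < K" "K * \<eta> \<le> 1"
    and s: "0 \<le> s"
  shows "0 < measure N A \<and> measure N A' \<le> 4 * s * measure N A"
proof -
  interpret N: prob_space N by fact
  have spN: "space N = space M" using sets by (rule sets_eq_imp_space_eq)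
  note meas[measurable] 
  have measN[measurable]: "(\<lambda>\<theta>. p n \<theta> x) \<in> borel_measurable N"
    using meas sets by (simp cong: measurable_cong_sets)
  define mE where "mE = marg_lik M p n x"
  define mB where "mB = marg_lik N p n x"
  let ?E = "posterior M p n x" and ?B = "posterior N p n x"
  interpret E: prob_space ?E by fact
  interpret B: finite_measure ?B by (intro finite_measure_posterior measN)
  have [simp]: "sets ?E = sets M" "space ?E = space M" "sets ?B = sets M" "space ?B = space M"
    by (auto simp: posterior_def sets spN)
  have M1': "emeasure M C \<le> 1" for C
    using emeasure_space[of M C] M1 by (rule order_trans)
  have tvA: "measure ?B C \<le> measure ?E C + \<eta>" if "C \<in> sets M" for C
    using measure_le_add_tv_dist[OF E.finite_measure_axioms B.finite_measure_axioms, of C] tv that by simp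
  have tvE: "measure ?E C \<le> measure ?B C + \<eta>" if "C \<in> sets M" for C
  proof -
    have "tv_dist ?B ?E = tv_dist ?E ?B" by (simp add: tv_dist_def abs_minus_commute)
    then show ?thesis
      using measure_le_add_tv_dist[OF B.finite_measure_axioms E.finite_measure_axioms, of C] tv that by simp
  qed

  \<comment> \<open>Off \<open>A\<close> the likelihood is at most \<open>f0 / 4\<close>, while the
    normalizing constant is at least \<open>f0\<close> and the prior mass at most 1.\<close>
  have E_off: "emeasure ?E (space M - A) \<le> ennreal (1/4)"
  proof -
    have "(\<integral>\<^sup>+\<theta>\<in>space M - A. ennreal (p n \<theta> x) \<partial>M) \<le> (\<integral>\<^sup>+\<theta>\<in>space M - A. ennreal (f0 / 4) \<partial>M)"
      using A(2) by (intro nn_integral_mono) (auto simp: indicator_def intro!: ennreal_leI)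
    also have "\<dots> = ennreal (f0 / 4) * emeasure M (space M - A)"
      using A(1) by (intro nn_integral_cmult_indicator) auto
    also have "\<dots> \<le> ennreal (f0 / 4)"
      using mult_left_mono[OF M1', of "ennreal (f0/4)"] by simp
    also have "\<dots> = ennreal (1/4) * ennreal f0" using f0 by (simp add: ennreal_mult[symmetric])
    also have "\<dots> \<le> ennreal (1/4) * mE" using f0 unfolding mE_def by (intro mult_left_mono) auto
    finally have "emeasure ?E (space M - A) \<le> ennreal (1/4) * mE / mE"
      using A(1) by (subst emeasure_posterior[where p = p and n = n and x = x, OF meas]) (auto simp: mE_def intro: divide_right_mono_ennreal)
    also have "\<dots> = ennreal (1/4) * (mE / mE)" by (simp add: ennreal_times_divide)
    also have "\<dots> \<le> ennreal (1/4) * 1" by (intro mult_left_mono ennreal_divide_self_le_1) auto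
    finally show ?thesis by simp
  qed
  then have "measure ?E (space M - A) \<le> 1/4"
    by (simp add: E.emeasure_eq_measure)
  then have "3/4 \<le> measure ?E A" using E.prob_compl[of A] A(1) by simp
  then have Bhalf: "1/2 \<le> measure ?B A" using tvE[OF A(1)] \<eta> by linarith
  then have Bhalf': "ennreal (1/2) \<le> emeasure ?B A" unfolding B.emeasure_eq_measure by (rule ennreal_leI)
  have BA: "emeasure ?B A = (\<integral>\<^sup>+\<theta>\<in>A. ennreal (p n \<theta> x) \<partial>N) / mB"
    unfolding mB_def using A(1) sets by (intro emeasure_posterior[where p = p and n = n and x = x] measN) auto
  have intA: "(\<integral>\<^sup>+\<theta>\<in>A. ennreal (p n \<theta> x) \<partial>N) \<le> ennreal (s * f0 * measure N A)"
  proof -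
    have "(\<integral>\<^sup>+\<theta>\<in>A. ennreal (p n \<theta> x) \<partial>N) \<le> (\<integral>\<^sup>+\<theta>\<in>A. ennreal (s * f0) \<partial>N)"
      using A(3) by (intro nn_integral_mono) (auto simp: indicator_def intro!: ennreal_leI)
    also have "\<dots> = ennreal (s * f0) * emeasure N A"
      using A(1) sets by (intro nn_integral_cmult_indicator) auto
    finally show ?thesis using s f0 by (simp add: N.emeasure_eq_measure ennreal_mult)
  qed
  \<comment> \<open>If \<open>mB = 0\<close>, the posterior is the null measure.\<close>
  have "mB \<noteq> 0"
  proof
    assume "mB = 0"
    have "(\<integral>\<^sup>+\<theta>\<in>A. ennreal (p n \<theta> x) \<partial>N) \<le> mB"
      unfolding mB_def marg_lik_def by (intro nn_integral_mono) (auto simp: indicator_def)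
    then have "emeasure ?B A = 0" using BA \<open>mB = 0\<close> by simp
    then show False using Bhalf' by simp
  qed
  then obtain m where m: "mB = ennreal m" "0 < m"
    using fin unfolding mB_def[symmetric] by (cases mB) (auto simp: less_le)
  have "ennreal (1/2) \<le> ennreal (s * f0 * measure N A) / ennreal m"
    using Bhalf' BA intA m by (metis divide_right_mono_ennreal order_trans)
  also have "\<dots> = ennreal (s * f0 * measure N A / m)"
    using m s f0 by (intro divide_ennreal) auto
  finally have "1/2 \<le> s * f0 * measure N A / m"
    by (subst (asm) ennreal_le_iff) (use s f0 m in auto)
  then have mle: "m \<le> 2 * s * f0 * measure N A" using m by (simp add: field_simps)
  then have "measure N A \<noteq> 0" using m by auto
  then have pos: "0 < measure N A" by (simp add: zero_less_measure_iff)

  \<comment> \<open>The inverse likelihood ratio, cut off outside \<open>A'\<close>; the cut-off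
    bounds it by \<open>K\<close>, as the transfer between the posteriors requires.\<close>
  define g where "g \<theta> = indicator A' \<theta> * (f0 / p n \<theta> x)" for \<theta>
  have pA': "0 < p n \<theta> x" if "\<theta> \<in> A'" for \<theta>
    using A'(2)[OF that] f0 K by (metis less_le_trans zero_less_mult_pos)
  have gK: "g \<theta> \<le> K" for \<theta>
    using A'(2)[of \<theta>] pA'[of \<theta>] K by (auto simp: g_def indicator_def field_simps)
  \<comment> \<open>The likelihood cancels between \<open>g\<close> and the posterior density,
    leaving a constant on \<open>A'\<close>. Both priors are inserted for \<open>Q\<close>
    below.\<close>
  have int_g: "(\<integral>\<^sup>+\<theta>. ennreal (g \<theta>) \<partial>posterior Q p n x) = ennreal f0 / marg_lik Q p n x * emeasure Q A'"
    if Q: "sets Q = sets M" for Q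
  proof -
    have [measurable]: "(\<lambda>\<theta>. p n \<theta> x) \<in> borel_measurable Q" "A' \<in> sets Q"
      using meas Q A'(1) by (simp_all cong: measurable_cong_sets)
    have [measurable]: "g \<in> borel_measurable Q" unfolding g_def by measurable
    have "(\<integral>\<^sup>+\<theta>. ennreal (g \<theta>) \<partial>posterior Q p n x)
      = (\<integral>\<^sup>+\<theta>. ennreal (p n \<theta> x) / marg_lik Q p n x * ennreal (g \<theta>) \<partial>Q)"
      unfolding posterior_def by (intro nn_integral_density) measurable
    also have "\<dots> = (\<integral>\<^sup>+\<theta>\<in>A'. ennreal f0 / marg_lik Q p n x \<partial>Q)"
    proof (intro nn_integral_cong)
      fix \<theta> assume "\<theta> \<in> space Q"
      show "ennreal (p n \<theta> x) / marg_lik Q p n x * ennreal (g \<theta>) = ennreal f0 / marg_lik Q p n x * indicator A' \<theta>"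
      proof (cases "\<theta> \<in> A'")
        case True
        then have "ennreal (p n \<theta> x) * ennreal (f0 / p n \<theta> x) = ennreal f0"
          using pA'[OF True] f0 by (simp add: ennreal_mult[symmetric])
        then show ?thesis using True
          by (simp add: g_def divide_ennreal_def mult_ac) (metis mult.assoc mult.commute)
      qed (simp add: g_def)
    qed
    also have "\<dots> = ennreal f0 / marg_lik Q p n x * emeasure Q A'"
      by (intro nn_integral_cmult_indicator) measurable
    finally show ?thesis .
  qed
  have "(\<integral>\<^sup>+\<theta>. ennreal (g \<theta>) \<partial>?B) \<le> (\<integral>\<^sup>+\<theta>. ennreal (g \<theta>) \<partial>?E) + ennreal (K * \<eta>)"
  proof (rule nn_integral_le_of_emeasure_le)
    show "sigma_finite_measure ?B" "sigma_finite_measure ?E" by unfold_locales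
    show "g \<in> borel_measurable ?B"
      using A'(1) unfolding g_def by (subst measurable_cong_sets[of _ M]) auto
    fix C assume "C \<in> sets ?B"
    then show "emeasure ?B C \<le> emeasure ?E C + ennreal \<eta>"
      using tvA[of C] \<eta> by (simp add: B.emeasure_eq_measure E.emeasure_eq_measure ennreal_plus[symmetric] del: ennreal_plus)
  qed (use K \<eta> gK in auto)
  also have "(\<integral>\<^sup>+\<theta>. ennreal (g \<theta>) \<partial>?E) \<le> 1"
  proof -
    have "ennreal f0 / mE \<le> mE / mE" using f0 unfolding mE_def by (intro divide_right_mono_ennreal)
    also have "\<dots> \<le> 1" by (rule ennreal_divide_self_le_1)
    finally have "ennreal f0 / mE * emeasure M A' \<le> 1 * 1" by (intro mult_mono M1') auto
    then show ?thesis using int_g[OF refl] by (simp add: mE_def)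
  qed
  also have "(\<integral>\<^sup>+\<theta>. ennreal (g \<theta>) \<partial>?B) = ennreal (f0 / m * measure N A')"
    using m f0 int_g[OF sets] by (simp add: mB_def[symmetric] N.emeasure_eq_measure divide_ennreal ennreal_mult'[symmetric])
  finally have "ennreal (f0 / m * measure N A') \<le> ennreal (1 + K * \<eta>)"
    using K \<eta> by (simp add: add_mono)
  then have "f0 / m * measure N A' \<le> 1 + K * \<eta>"
    using K \<eta> by (subst (asm) ennreal_le_iff) auto
  \<comment> \<open>The 4 in the conclusion is this factor 2 times the factor 2 in
    \<open>mle\<close>, which came from posterior mass at least 1/2 on \<open>A\<close>.\<close>
  then have "f0 / m * measure N A' \<le> 2" using K by linarith
  then have "f0 * measure N A' \<le> 2 * m" using m by (simp add: field_simps)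
  also have "\<dots> \<le> 4 * s * f0 * measure N A" using mle by (simp add: mult_ac)
  finally have "f0 * measure N A' \<le> f0 * (4 * s * measure N A)" by (simp add: mult_ac)
  then show ?thesis using f0 pos by simp
qed

section \<open>Incompatible growth rates of the local prior mass\<close>

text \<open>Shrinking the radius by a factor \<open>L > K\<close> costs \<open>V\<close> at most a
  factor \<open>K\<close>. After \<open>j\<close> rounds the linear bound gives
  \<open>V r \<le> C * r * (K / L) ^ j\<close>, which tends to 0, although \<open>V r\<close> is
  positive.\<close>

lemma no_uniform_scaling:
  fixes V :: "real \<Rightarrow> real"
  assumes "0 < \<delta>" "0 \<le> C" and lin: "\<And>r. 0 < r \<Longrightarrow> r \<le> \<delta> \<Longrightarrow> V r \<le> C * r"
    and "0 < r0" "0 < K"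
    and ev: "\<And>R. 0 < R \<Longrightarrow> \<forall>\<^sub>F n in sequentially.
      0 < V (r0 / sqrt (real n)) \<and> V (R / sqrt (real n)) \<le> K * V (r0 / sqrt (real n))"
  shows False
proof -
  \<comment> \<open>\<open>L\<close> is a natural number so that every scale
    \<open>r / L ^ j\<close> is \<open>r0 / sqrt n\<close> for an integer \<open>n\<close>, namely
    \<open>n1 * L ^ (2 * j)\<close>. All rounds use the same ratio \<open>L\<close>, hence a single
    threshold \<open>N\<close>.\<close>
  obtain L :: nat where "max K 1 < real L" using reals_Archimedean2 by blast
  then have L: "K < real L" "1 < L" by auto
  have L1: "1 \<le> L" using L by simp
  have "0 < real L * r0" using L1 \<open>0 < r0\<close> by simp
  from ev[OF this] obtain N where N: "\<And>n. N \<le> n \<Longrightarrow> 0 < V (r0 / sqrt (real n))"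
    "\<And>n. N \<le> n \<Longrightarrow> V (real L * r0 / sqrt (real n)) \<le> K * V (r0 / sqrt (real n))"
    unfolding eventually_sequentially by blast
  define n1 where "n1 = max N 1"
  define r where "r = r0 / sqrt (real n1)"
  have n1: "1 \<le> n1" "N \<le> n1" by (auto simp: n1_def)
  have r: "0 < r" using \<open>0 < r0\<close> n1 by (simp add: r_def)
  have rj: "r / real L ^ j = r0 / sqrt (real (n1 * L ^ (2 * j)))" for j
  proof -
    have "sqrt (real (L ^ (2 * j))) = real L ^ j"
      by (rule real_sqrt_unique) (simp_all add: power_mult[symmetric] mult.commute)
    then show ?thesis by (simp add: r_def real_sqrt_mult)
  qed
  have nj: "N \<le> n1 * L ^ (2 * j)" for j
    using n1(2) L1 by (metis le_trans mult_le_mono2 nat_mult_1_right one_le_power)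
  have step: "V (r / real L ^ j) \<le> K * V (r / real L ^ Suc j)" for j
  proof -
    have "r / real L ^ j = real L * (r / real L ^ Suc j)" using L1 by simp
    also have "\<dots> = real L * r0 / sqrt (real (n1 * L ^ (2 * Suc j)))" unfolding rj by simp
    finally have "V (r / real L ^ j) = V (real L * r0 / sqrt (real (n1 * L ^ (2 * Suc j))))" by simp
    also have "\<dots> \<le> K * V (r0 / sqrt (real (n1 * L ^ (2 * Suc j))))" by (intro N(2) nj)
    finally show ?thesis unfolding rj .
  qed
  have iter: "V r \<le> K ^ j * V (r / real L ^ j)" for j
  proof (induction j)
    case (Suc j)
    have "V r \<le> K ^ j * V (r / real L ^ j)" by fact
    also have "\<dots> \<le> K ^ j * (K * V (r / real L ^ Suc j))"
      using step[of j] \<open>0 < K\<close> by (intro mult_left_mono) auto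
    finally show ?case by (simp add: mult_ac)
  qed simp
  have q: "0 \<le> K / real L" "K / real L < 1" using L L1 \<open>0 < K\<close> by auto
  have lim: "(\<lambda>j. C * r * (K / real L) ^ j) \<longlonglongrightarrow> 0"
    using tendsto_mult_left[OF LIMSEQ_power_zero[of "K / real L"], of "C * r"] q by simp
  \<comment> \<open>The linear bound is available only once the scale has dropped below
    \<delta>.\<close>
  have "(\<lambda>j. r * (1 / real L) ^ j) \<longlonglongrightarrow> 0"
    using tendsto_mult_left[OF LIMSEQ_power_zero[of "1 / real L"], of r] L by simp
  then have "\<forall>\<^sub>F j in sequentially. r * (1 / real L) ^ j < \<delta>"
    using \<open>0 < \<delta>\<close> by (rule order_tendstoD)
  then have "\<forall>\<^sub>F j in sequentially. V r \<le> C * r * (K / real L) ^ j"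
  proof eventually_elim
    case (elim j)
    have "V r \<le> K ^ j * V (r / real L ^ j)" by (rule iter)
    also have "\<dots> \<le> K ^ j * (C * (r / real L ^ j))"
      using elim r L1 \<open>0 < K\<close> by (intro mult_left_mono lin) (auto simp: power_one_over field_simps)
    finally show ?case by (simp add: power_divide mult_ac)
  qed
  then have "V r \<le> 0" using lim by (intro tendsto_lowerbound[OF lim]) auto
  moreover have "0 < V r" unfolding r_def using n1 by (intro N(1))
  ultimately show False by simp
qed

section \<open>Local analysis under the quadratic expansion\<close>

text \<open>The constants are the extrema of the quadratic form on the compact unit sphere;
  homogeneity extends the bounds to all vectors.\<close>

lemma positive_definite_bounds:
  fixes A :: "real^'k^'k"
  assumes "positive_definite A"
  obtains a b where "0 < a" "0 < b" "\<And>v. a * (norm v)\<^sup>2 \<le> v \<bullet> (A *v v)" "\<And>v. v \<bullet> (A *v v) \<le> b * (norm v)\<^sup>2"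
proof -
  have cont: "continuous_on S (\<lambda>v. v \<bullet> (A *v v))" for S
    by (intro continuous_intros linear_continuous_on matrix_vector_mul_bounded_linear)
  have ne: "sphere (0::real^'k) 1 \<noteq> {}" by simp
  obtain u where u: "u \<in> sphere 0 1" "\<And>v. v \<in> sphere 0 1 \<Longrightarrow> u \<bullet> (A *v u) \<le> v \<bullet> (A *v v)"
    using continuous_attains_inf[OF compact_sphere ne cont] by blast
  obtain w where w: "w \<in> sphere 0 1" "\<And>v. v \<in> sphere 0 1 \<Longrightarrow> v \<bullet> (A *v v) \<le> w \<bullet> (A *v w)"
    using continuous_attains_sup[OF compact_sphere ne cont] by blast
  have pos: "0 < x \<bullet> (A *v x)" if "x \<in> sphere 0 1" for x
  proof -
    have "x \<noteq> 0" using that by auto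
    then show ?thesis using assms by (auto simp: positive_definite_def)
  qed
  have scale: "v \<bullet> (A *v v) = (norm v)\<^sup>2 * ((v /\<^sub>R norm v) \<bullet> (A *v (v /\<^sub>R norm v)))" and
    "v /\<^sub>R norm v \<in> sphere 0 1" if "v \<noteq> 0" for v
    using that by (auto simp: matrix_vector_mult_scaleR power2_eq_square field_simps)
  show thesis
  proof
    show "0 < u \<bullet> (A *v u)" "0 < w \<bullet> (A *v w)" using pos u w by auto
    fix v
    show "u \<bullet> (A *v u) * (norm v)\<^sup>2 \<le> v \<bullet> (A *v v)"
      using scale[of v] u(2)[of "v /\<^sub>R norm v"] by (cases "v = 0") (auto simp: mult.commute mult_left_mono)
    show "v \<bullet> (A *v v) \<le> w \<bullet> (A *v w) * (norm v)\<^sup>2"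
      using scale[of v] w(2)[of "v /\<^sub>R norm v"] by (cases "v = 0") (auto simp: mult.commute mult_left_mono)
  qed
qed

text \<open>The expansion with \<epsilon> = 1/2, exponentiated. Applied at \<open>t0\<close>, its
  upper bound and \<open>D\<close> give \<open>q t0 / 2 \<le> 1/2\<close> and a likelihood at
  \<open>t\<close> at most \<open>exp (1/2) \<le> 2\<close> times that at \<open>t0\<close>.\<close>

lemma LAN_density_bounds:
  fixes q :: "'p \<Rightarrow> real"
  assumes LAN: "\<And>\<theta>. \<theta> \<in> U \<Longrightarrow> ereal (- q \<theta> * (3/2)) \<le> log_lik p n \<theta> x - log_lik p n t x \<and>
      log_lik p n \<theta> x - log_lik p n t x \<le> ereal (- q \<theta> * (1/2))"
    and nonneg: "\<And>\<theta>. \<theta> \<in> U \<Longrightarrow> 0 \<le> p n \<theta> x" "0 \<le> p n t x"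
    and t0: "t0 \<in> U" "0 < p n t0 x" and q: "0 \<le> q t0"
    and D: "real_of_ereal (2 * (log_lik p n t x - log_lik p n t0 x)) \<le> 1"
  shows "q t0 \<le> 1" "p n t0 x \<le> p n t x" "p n t x \<le> 2 * p n t0 x"
    "\<And>\<theta>. \<theta> \<in> U \<Longrightarrow> p n t x * exp (- (3/2) * q \<theta>) \<le> p n \<theta> x"
    "\<And>\<theta>. \<theta> \<in> U \<Longrightarrow> p n \<theta> x \<le> p n t x * exp (- q \<theta> / 2)"
proof -
  \<comment> \<open>Finiteness of both log-likelihoods: otherwise \<open>real_of_ereal\<close> would make \<open>D\<close> vacuous.\<close>
  have "p n t x \<noteq> 0"
    using LAN[OF t0(1)] t0(2) by (auto simp: log_lik_def)
  then have pt: "0 < p n t x" using nonneg by simp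
  \<comment> \<open>The lower bound in \<open>LAN\<close> is finite, which rules out a
    log-likelihood of -\<infinity> in \<open>U\<close>.\<close>
  have pos: "0 < p n \<theta> x" if "\<theta> \<in> U" for \<theta>
  proof -
    have "p n \<theta> x \<noteq> 0" using LAN[OF that] pt by (auto simp: log_lik_def)
    then show ?thesis using nonneg(1)[OF that] by simp
  qed
  have L: "- q \<theta> * (3/2) \<le> ln (p n \<theta> x) - ln (p n t x)" "ln (p n \<theta> x) - ln (p n t x) \<le> - q \<theta> * (1/2)"
    if "\<theta> \<in> U" for \<theta>
    using LAN[OF that] pt pos[OF that] by (auto simp: log_lik_def)
  have D': "ln (p n t x) - ln (p n t0 x) \<le> 1/2"
    using D pt t0(2) by (simp add: log_lik_def)
  show "q t0 \<le> 1" using L[OF t0(1)] D' by linarith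
  have "ln (p n t0 x) \<le> ln (p n t x)" using L(2)[OF t0(1)] q by linarith
  then show "p n t0 x \<le> p n t x" using pt t0(2) by simp
  have "ln (p n t x) \<le> ln (p n t0 x * exp (1/2))" using D' t0(2) by (simp add: ln_mult)
  then have "p n t x \<le> p n t0 x * exp (1/2)" using pt t0(2) by (subst (asm) ln_le_cancel_iff) auto
  also have "\<dots> \<le> p n t0 x * 2" using t0(2) exp_half_le2 by (intro mult_left_mono) auto
  finally show "p n t x \<le> 2 * p n t0 x" by simp
  fix \<theta> assume \<theta>: "\<theta> \<in> U"
  have "ln (p n t x * exp (- (3/2) * q \<theta>)) \<le> ln (p n \<theta> x)" using L(1)[OF \<theta>] pt by (simp add: ln_mult)
  then show "p n t x * exp (- (3/2) * q \<theta>) \<le> p n \<theta> x"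
    using pt pos[OF \<theta>] by (subst (asm) ln_le_cancel_iff) auto
  have "ln (p n \<theta> x) \<le> ln (p n t x * exp (- q \<theta> / 2))" using L(2)[OF \<theta>] pt by (simp add: ln_mult)
  then show "p n \<theta> x \<le> p n t x * exp (- q \<theta> / 2)"
    using pt pos[OF \<theta>] by (subst (asm) ln_le_cancel_iff) auto
qed

text \<open>The posteriors are compared on sublevel sets of the quadratic form centred at
  \<open>t\<close>. These are then exchanged for Euclidean balls centred at the fixed point
  \<open>t0\<close>, so that the conclusion no longer depends on the sample.\<close>

lemma posterior_local_mass:
  fixes M N :: "(real^'k) measure" and A :: "real^'k^'k"
  assumes sets: "sets M = sets (restrict_space borel \<Theta>)" "sets N = sets (restrict_space borel \<Theta>)"
    and M1: "emeasure M (space M) \<le> 1" and N: "prob_space N"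
    and meas: "(\<lambda>\<theta>. p n \<theta> x) \<in> borel_measurable (restrict_space borel \<Theta>)"
    and nonneg: "\<And>\<theta>. \<theta> \<in> \<Theta> \<Longrightarrow> 0 \<le> p n \<theta> x"
    and E: "prob_space (posterior M p n x)"
    and f0: "0 < p n t0 x" "ennreal (p n t0 x) \<le> marg_lik M p n x"
    and fin: "marg_lik N p n x < \<infinity>"
    and tv: "tv_dist (posterior M p n x) (posterior N p n x) \<le> \<eta>"
    and U: "U \<in> sets (restrict_space borel \<Theta>)" "t0 \<in> U" and t: "t \<in> \<Theta>" and n: "1 \<le> n"
    and off: "\<And>\<theta>. \<theta> \<in> \<Theta> - U \<Longrightarrow> p n \<theta> x \<le> p n t0 x / 4"
    and LAN: "\<And>\<theta>. \<theta> \<in> U \<Longrightarrow>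
      ereal (- (real n * ((\<theta> - t) \<bullet> (A *v (\<theta> - t))) / 2) * (3/2)) \<le> log_lik p n \<theta> x - log_lik p n t x \<and>
      log_lik p n \<theta> x - log_lik p n t x \<le> ereal (- (real n * ((\<theta> - t) \<bullet> (A *v (\<theta> - t))) / 2) * (1/2))"
    and D: "real_of_ereal (2 * (log_lik p n t x - log_lik p n t0 x)) \<le> 1"
    and ab: "0 < a" "0 < b" "\<And>v. a * (norm v)\<^sup>2 \<le> v \<bullet> (A *v v)" "\<And>v. v \<bullet> (A *v v) \<le> b * (norm v)\<^sup>2"
    and R: "0 < R" and \<eta>: "0 \<le> \<eta>" "\<eta> \<le> 1/4" "exp ((3/2) * (b * (R + sqrt (2/a))\<^sup>2 / 2)) * \<eta> \<le> 1"
    and r0: "r0 = sqrt (4 * ln 8 / a) + sqrt (2 / a)"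
  shows "0 < measure N (U \<inter> cball t0 (r0 / sqrt (real n)))"
    and "measure N (U \<inter> cball t0 (R / sqrt (real n))) \<le> 8 * measure N (U \<inter> cball t0 (r0 / sqrt (real n)))"
proof -
  interpret N: prob_space N by fact
  define q where "q \<theta> = real n * ((\<theta> - t) \<bullet> (A *v (\<theta> - t))) / 2" for \<theta>
  have U\<Theta>: "U \<subseteq> \<Theta>" using sets.sets_into_space[OF U(1)] by (simp add: space_restrict_space)
  have sp: "space M = \<Theta>" using sets_eq_imp_space_eq[OF sets(1)] by (simp add: space_restrict_space)
  have n0: "0 < real n" using n by simp
  have q_lower: "a * (norm (\<theta> - t))\<^sup>2 \<le> 2 * q \<theta> / n" for \<theta>
    using ab(3)[of "\<theta> - t"] n0 by (simp add: q_def)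
  have q_upper: "q \<theta> \<le> real n * (b * (norm (\<theta> - t))\<^sup>2) / 2" for \<theta>
    using ab(4)[of "\<theta> - t"] n0 by (simp add: q_def)
  have q0: "0 \<le> q \<theta>" for \<theta>
  proof -
    have "0 \<le> 2 * q \<theta> / n" using q_lower[of \<theta>] ab(1) by (meson mult_nonneg_nonneg less_imp_le order_trans zero_le_power2)
    then show ?thesis using n0 by (simp add: zero_le_divide_iff)
  qed
  have LAN': "ereal (- q \<theta> * (3/2)) \<le> log_lik p n \<theta> x - log_lik p n t x \<and>
      log_lik p n \<theta> x - log_lik p n t x \<le> ereal (- q \<theta> * (1/2))" if "\<theta> \<in> U" for \<theta>
    using LAN[OF that] unfolding q_def .
  note B = LAN_density_bounds[where p = p and n = n and x = x and q = q and U = U and t = t and ?t0.0 = t0,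
      OF LAN' nonneg nonneg[OF t] U(2) f0(1) q0 D]
  have B1: "q t0 \<le> 1" "p n t0 x \<le> p n t x" "p n t x \<le> 2 * p n t0 x"
    and B2: "\<And>\<theta>. \<theta> \<in> U \<Longrightarrow> p n t x * exp (- (3/2) * q \<theta>) \<le> p n \<theta> x"
      "\<And>\<theta>. \<theta> \<in> U \<Longrightarrow> p n \<theta> x \<le> p n t x * exp (- q \<theta> / 2)"
    using B U\<Theta> by blast+
  have q_norm: "norm (\<theta> - t) \<le> sqrt (2 * c / a) / sqrt (real n)" if "q \<theta> \<le> c" for \<theta> c
  proof -
    have "2 * q \<theta> / n \<le> 2 * c / n" using that n0 by (intro divide_right_mono) auto
    then have "a * (norm (\<theta> - t))\<^sup>2 \<le> 2 * c / n" using q_lower[of \<theta>] by linarith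
    then have "(norm (\<theta> - t))\<^sup>2 \<le> 2 * c / a / n" using ab(1) n0 by (simp add: field_simps)
    then have "norm (\<theta> - t) \<le> sqrt (2 * c / a / n)" by (rule real_le_rsqrt)
    then show ?thesis by (simp add: real_sqrt_divide real_sqrt_mult)
  qed
  \<comment> \<open>The centre of the expansion is within order \<open>1 / sqrt n\<close> of
    \<open>t0\<close>; this shift is the term \<open>sqrt (2/a)\<close> in \<open>r0\<close> and in
    \<open>c\<close>.\<close>
  have t0t: "norm (t0 - t) \<le> sqrt (2 / a) / sqrt (real n)" using q_norm[OF B1(1)] by simp
  \<comment> \<open>\<open>c\<close> bounds \<open>q\<close> on the ball of radius
    \<open>R / sqrt n\<close> around \<open>t0\<close>. Beyond the level \<open>2 * ln 8\<close> the
    factor \<open>exp (- q \<theta> / 2)\<close> is below 1/8, so with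
    \<open>p n t x \<le> 2 * p n t0 x\<close> the likelihood is at most a quarter of that at
    \<open>t0\<close>.\<close>
  define c where "c = b * (R + sqrt (2/a))\<^sup>2 / 2"
  let ?C = "{\<theta>\<in>U. q \<theta> \<le> 2 * ln 8}" and ?C' = "{\<theta>\<in>U. q \<theta> \<le> c}"
  have cont: "continuous_on UNIV q"
    unfolding q_def
    by (intro continuous_intros continuous_on_compose2[OF linear_continuous_on[OF matrix_vector_mul_bounded_linear[of A], of UNIV]]) auto
  have Cset: "{\<theta>\<in>U. q \<theta> \<le> s} \<in> sets (restrict_space borel \<Theta>)" for s
  proof -
    have "{\<theta>. q \<theta> \<le> s} \<in> sets borel"
      using borel_measurable_continuous_onI[OF cont] by measurable
    then have "\<Theta> \<inter> {\<theta>. q \<theta> \<le> s} \<in> sets (restrict_space borel \<Theta>)" by (auto simp: sets_restrict_space)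
    then have "U \<inter> (\<Theta> \<inter> {\<theta>. q \<theta> \<le> s}) \<in> sets (restrict_space borel \<Theta>)" using U(1) by blast
    moreover have "U \<inter> (\<Theta> \<inter> {\<theta>. q \<theta> \<le> s}) = {\<theta>\<in>U. q \<theta> \<le> s}" using U\<Theta> by auto
    ultimately show ?thesis by simp
  qed
  have cballset: "U \<inter> cball t0 r \<in> sets N" for r
  proof -
    have "\<Theta> \<inter> cball t0 r \<in> sets (restrict_space borel \<Theta>)" by (auto simp: sets_restrict_space)
    then have "U \<inter> (\<Theta> \<inter> cball t0 r) \<in> sets (restrict_space borel \<Theta>)" using U(1) by blast
    moreover have "U \<inter> (\<Theta> \<inter> cball t0 r) = U \<inter> cball t0 r" using U\<Theta> by auto
    ultimately show ?thesis using sets(2) by simp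
  qed
  have K\<eta>: "exp ((3/2) * c) * \<eta> \<le> 1" using \<eta>(3) by (simp only: c_def)
  have main: "0 < measure N ?C \<and> measure N ?C' \<le> 4 * 2 * measure N ?C"
  proof (rule posterior_comparison[where p = p and n = n and x = x and N = N and M = M
        and ?f0.0 = "p n t0 x" and \<eta> = \<eta> and A = ?C and A' = ?C' and s = 2 and K = "exp ((3/2) * c)"])
    fix \<theta> assume "\<theta> \<in> ?C"
    then have "p n \<theta> x \<le> p n t x * exp (- q \<theta> / 2)" using B2(2) by blast
    also have "\<dots> \<le> p n t x * 1" using q0[of \<theta>] B1(2) f0(1) by (intro mult_left_mono) auto
    finally show "p n \<theta> x \<le> 2 * p n t0 x" using B1(3) by simp
  next
    fix \<theta> assume \<theta>: "\<theta> \<in> space M - ?C"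
    show "p n \<theta> x \<le> p n t0 x / 4"
    proof (cases "\<theta> \<in> U")
      case True
      then have "exp (- q \<theta> / 2) \<le> exp (- ln (8::real))" using \<theta> by auto
      also have "\<dots> = 1/8" by (simp add: exp_minus)
      finally have "p n t x * exp (- q \<theta> / 2) \<le> (2 * p n t0 x) * (1/8)"
        using B1(3) f0(1) by (intro mult_mono) auto
      then show ?thesis using B2(2)[OF True] by simp
    qed (use \<theta> off sp in auto)
  next
    fix \<theta> assume \<theta>: "\<theta> \<in> ?C'"
    have "p n t0 x \<le> p n t x" by (rule B1)
    also have "\<dots> = exp ((3/2) * q \<theta>) * (p n t x * exp (- (3/2) * q \<theta>))"
      by (simp add: exp_minus field_simps)
    also have "\<dots> \<le> exp ((3/2) * c) * p n \<theta> x"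
      using \<theta> B2(1)[of \<theta>] B1(2) f0(1) by (intro mult_mono) auto
    finally show "p n t0 x \<le> exp ((3/2) * c) * p n \<theta> x" .
  next
    show "(\<lambda>\<theta>. p n \<theta> x) \<in> borel_measurable M"
      using meas sets(1) by (simp cong: measurable_cong_sets)
  qed (use assms sp Cset K\<eta> in simp_all)
  have sub: "?C \<subseteq> U \<inter> cball t0 (r0 / sqrt (real n))"
  proof safe
    fix \<theta> assume "\<theta> \<in> U" "q \<theta> \<le> 2 * ln 8"
    have "norm (\<theta> - t0) \<le> norm (\<theta> - t) + norm (t0 - t)" using norm_triangle_ineq4[of "\<theta> - t" "t0 - t"] by simp
    also have "\<dots> \<le> r0 / sqrt (real n)"
      using q_norm[OF \<open>q \<theta> \<le> 2 * ln 8\<close>] t0t by (simp add: r0 add_divide_distrib)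
    finally show "\<theta> \<in> cball t0 (r0 / sqrt (real n))" by (simp add: dist_norm norm_minus_commute)
  qed
  have sub': "U \<inter> cball t0 (R / sqrt (real n)) \<subseteq> ?C'"
  proof safe
    fix \<theta> assume "\<theta> \<in> cball t0 (R / sqrt (real n))"
    then have "norm (\<theta> - t) \<le> R / sqrt (real n) + sqrt (2 / a) / sqrt (real n)"
      using t0t norm_triangle_ineq[of "\<theta> - t0" "t0 - t"] by (simp add: dist_norm norm_minus_commute)
    then have "norm (\<theta> - t) \<le> (R + sqrt (2/a)) / sqrt (real n)" by (simp add: add_divide_distrib)
    then have "(norm (\<theta> - t))\<^sup>2 \<le> ((R + sqrt (2/a)) / sqrt (real n))\<^sup>2" by (intro power_mono) auto
    also have "\<dots> = (R + sqrt (2/a))\<^sup>2 / n" by (simp add: power_divide)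
    finally have "real n * (b * (norm (\<theta> - t))\<^sup>2) / 2 \<le> real n * (b * ((R + sqrt (2/a))\<^sup>2 / n)) / 2"
      using ab(2) n0 by (intro divide_right_mono mult_left_mono) auto
    also have "\<dots> = c" using n0 by (simp add: c_def)
    finally show "q \<theta> \<le> c" using q_upper[of \<theta>] by linarith
  qed
  have "measure N ?C \<le> measure N (U \<inter> cball t0 (r0 / sqrt (real n)))"
    by (intro N.finite_measure_mono sub cballset)
  moreover have "measure N (U \<inter> cball t0 (R / sqrt (real n))) \<le> measure N ?C'"
    using Cset sets by (intro N.finite_measure_mono sub') auto
  ultimately show "0 < measure N (U \<inter> cball t0 (r0 / sqrt (real n)))"
    "measure N (U \<inter> cball t0 (R / sqrt (real n))) \<le> 8 * measure N (U \<inter> cball t0 (r0 / sqrt (real n)))"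
    using main by linarith+
qed

section \<open>Priors, including those at boundary hyperparameters\<close>

lemma sets_prior_of_density: "sets (prior_of_density \<Theta> f) = sets (restrict_space borel \<Theta>)"
  by (simp add: prior_of_density_def) (intro sets_restrict_space_cong, simp)

lemma prior_eq_prior_of_density: "l \<in> \<Lambda> \<Longrightarrow> prior \<Theta> \<Lambda> \<pi> l = prior_of_density \<Theta> (\<pi> l)"
  by (simp add: prior_def Let_def)

text \<open>The estimator may land on the boundary, where the prior is a weak limit or undefined. Of
  a limit, only its \<sigma>-algebra and its total mass are retained here.\<close>

lemma prior_cases:
  obtains "l \<in> \<Lambda>" "prior \<Theta> \<Lambda> \<pi> l = prior_of_density \<Theta> (\<pi> l)"
  | "sets (prior \<Theta> \<Lambda> \<pi> l) = sets (restrict_space borel \<Theta>)" "prob_space (prior \<Theta> \<Lambda> \<pi> l)"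
  | "prior \<Theta> \<Lambda> \<pi> l = null_measure (restrict_space borel \<Theta>)"
proof -
  let ?lim = "weak_limit_measure \<Theta> (at l within \<Lambda>) (\<lambda>l'. prior_of_density \<Theta> (\<pi> l'))"
  consider "l \<in> \<Lambda>" | "l \<notin> \<Lambda>" "\<exists>Q. ?lim Q" | "l \<notin> \<Lambda>" "\<not> (\<exists>Q. ?lim Q)" by blast
  then show thesis
  proof cases
    case 1 then show ?thesis using that(1) prior_eq_prior_of_density by blast
  next
    case 2
    then have "?lim (prior \<Theta> \<Lambda> \<pi> l)" by (auto simp: prior_def Let_def intro: someI)
    then show ?thesis using that(2) by (simp add: weak_limit_measure_def)
  next
    case 3
    then have "prior \<Theta> \<Lambda> \<pi> l = null_measure (restrict_space borel \<Theta>)" by (auto simp: prior_def Let_def)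
    then show ?thesis by (rule that(3))
  qed
qed

lemma sets_prior: "sets (prior \<Theta> \<Lambda> \<pi> l) = sets (restrict_space borel \<Theta>)"
  by (cases rule: prior_cases[where \<Theta> = \<Theta> and \<Lambda> = \<Lambda> and \<pi> = \<pi> and l = l])
    (simp_all add: sets_prior_of_density)

text \<open>An inequality, because an undefined prior is the null measure.\<close>

lemma emeasure_prior_le_1:
  assumes "\<And>l. l \<in> \<Lambda> \<Longrightarrow> prob_space (prior_of_density \<Theta> (\<pi> l))"
  shows "emeasure (prior \<Theta> \<Lambda> \<pi> l) A \<le> 1"
  using assms prob_space.emeasure_le_1
  by (cases rule: prior_cases[where \<Theta> = \<Theta> and \<Lambda> = \<Lambda> and \<pi> = \<pi> and l = l]) fastforce+

text \<open>Continuity bounds the density near \<open>t0\<close>, and a ball of radius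
  \<open>r \<le> 1\<close> has volume at most a constant times \<open>r\<close> in every
  dimension.\<close>

lemma prior_of_density_ball_linear:
  fixes \<Theta> :: "'a::euclidean_space set"
  assumes \<Theta>: "\<Theta> \<in> sets borel" and f: "f \<in> borel_measurable (restrict_space borel \<Theta>)"
    and cont: "continuous (at t0 within \<Theta>) f" and S: "S \<in> sets (restrict_space borel \<Theta>)"
  obtains \<delta> C where "0 < \<delta>" "0 \<le> C"
    "\<And>r. 0 < r \<Longrightarrow> r \<le> \<delta> \<Longrightarrow> measure (prior_of_density \<Theta> f) (S \<inter> cball t0 r) \<le> C * r"
proof -
  define B where "B = \<bar>f t0\<bar> + 1"
  have B0: "0 \<le> B" by (simp add: B_def)
  obtain \<delta>' where \<delta>': "0 < \<delta>'" "\<And>\<theta>. \<theta> \<in> \<Theta> \<Longrightarrow> dist \<theta> t0 < \<delta>' \<Longrightarrow> dist (f \<theta>) (f t0) < 1"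
    using cont unfolding continuous_within_eps_delta by (metis zero_less_one)
  \<comment> \<open>Halving makes closed balls fit into the open condition on
    \<open>\<delta>'\<close>; the cap 1 gives \<open>r ^ DIM('a) \<le> r\<close>.\<close>
  define \<delta> where "\<delta> = min (\<delta>' / 2) 1"
  let ?L = "restrict_space lborel \<Theta>"
  have [measurable]: "f \<in> borel_measurable ?L"
    using f sets_restrict_space_cong[OF sets_lborel, of \<Theta>] by (simp cong: measurable_cong_sets)
  have S\<Theta>: "S \<subseteq> \<Theta>" using sets.sets_into_space[OF S] by (simp add: space_restrict_space)
  have Sb: "S \<in> sets borel" using S \<Theta> by (auto simp: sets_restrict_space_iff)
  show thesis
  proof
    show "0 < \<delta>" using \<delta>' by (simp add: \<delta>_def)
    show "0 \<le> B * unit_ball_vol DIM('a)" by (auto simp: B_def)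
    fix r assume r: "0 < r" "r \<le> \<delta>"
    have fB: "f \<theta> \<le> B" if "\<theta> \<in> S \<inter> cball t0 r" for \<theta>
    proof -
      have "dist \<theta> t0 < \<delta>'" using that r \<delta>'(1) by (auto simp: \<delta>_def dist_commute min_def split: if_splits)
      then show ?thesis using \<delta>'(2)[of \<theta>] that S\<Theta> by (auto simp: B_def dist_real_def)
    qed
    have X: "S \<inter> cball t0 r \<in> sets ?L" using Sb S\<Theta> \<Theta> by (auto simp: sets_restrict_space_iff)
    have "emeasure (prior_of_density \<Theta> f) (S \<inter> cball t0 r) = (\<integral>\<^sup>+\<theta>\<in>S \<inter> cball t0 r. ennreal (f \<theta>) \<partial>?L)"
      unfolding prior_of_density_def using X by (intro emeasure_density) auto
    also have "\<dots> \<le> (\<integral>\<^sup>+\<theta>\<in>S \<inter> cball t0 r. ennreal B \<partial>?L)"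
      using fB by (intro nn_integral_mono) (auto simp: indicator_def intro!: ennreal_leI)
    also have "\<dots> = ennreal B * emeasure ?L (S \<inter> cball t0 r)"
      using X by (intro nn_integral_cmult_indicator)
    also have "emeasure ?L (S \<inter> cball t0 r) = emeasure lborel (S \<inter> cball t0 r)"
      using \<Theta> S\<Theta> by (intro emeasure_restrict_space) auto
    also have "\<dots> \<le> emeasure lborel (cball t0 r)" by (intro emeasure_mono) auto
    also have "\<dots> = ennreal (unit_ball_vol DIM('a) * r ^ DIM('a))" using r by (simp add: emeasure_cball)
    also have "\<dots> \<le> ennreal (unit_ball_vol DIM('a) * r)"
    proof (intro ennreal_leI mult_left_mono)
      show "r ^ DIM('a) \<le> r" using power_decreasing[of 1 "DIM('a)" r] r by (auto simp: \<delta>_def)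
    qed auto
    finally have "emeasure (prior_of_density \<Theta> f) (S \<inter> cball t0 r) \<le> ennreal (B * unit_ball_vol DIM('a) * r)"
      using B0 by (simp add: mult_left_mono ennreal_mult'[symmetric] mult.assoc)
    then show "measure (prior_of_density \<Theta> f) (S \<inter> cball t0 r) \<le> B * unit_ball_vol DIM('a) * r"
      using r unfolding measure_def by (intro enn2real_leI) (auto simp: B_def)
  qed
qed

lemma (in prob_space) prob_Int_ge:
  assumes "A \<in> events" "B \<in> events"
  shows "prob A + prob B - 1 \<le> prob (A \<inter> B)"
proof -
  have "prob (A \<union> B) \<le> 1" by (rule prob_le_1)
  then show ?thesis using finite_measure_Union'[OF assms] finite_measure_Diff'[OF assms(2,1)]
    by (simp add: Int_commute)
qed

lemma obs_measurable [measurable]: "obs n \<in> measurable seq_space (sample_space n)"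
  unfolding obs_def by (rule measurable_restrict_subset) auto

lemma log_lik_measurable:
  assumes "(\<lambda>x. p n (t x) x) \<in> borel_measurable M"
  shows "(\<lambda>x. log_lik p n (t x) x) \<in> borel_measurable M"
proof -
  note assms[measurable]
  show ?thesis unfolding log_lik_def by measurable
qed

text \<open>Applied to the true law, it makes the likelihood at the true value positive almost
  surely, so that it can be divided by.\<close>

lemma emeasure_density_zero_set:
  assumes "f \<in> borel_measurable \<nu>"
  shows "emeasure (density \<nu> (\<lambda>x. ennreal (f x))) {x\<in>space \<nu>. f x = 0} = 0"
proof -
  note assms[measurable]
  have "emeasure (density \<nu> (\<lambda>x. ennreal (f x))) {x\<in>space \<nu>. f x = 0}
    = (\<integral>\<^sup>+x\<in>{x\<in>space \<nu>. f x = 0}. ennreal (f x) \<partial>\<nu>)"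
    by (intro emeasure_density) measurable
  also have "\<dots> = (\<integral>\<^sup>+x. 0 \<partial>\<nu>)" by (intro nn_integral_cong) (auto simp: indicator_def)
  finally show ?thesis by simp
qed

theorem theorem5p1:
  fixes \<Theta> :: "(real^'k) set"
    and \<Lambda> :: "(real^'l) set"
    and P :: "real^'k \<Rightarrow> (nat \<Rightarrow> 'x::polish_space) measure"
    and \<nu> :: "nat \<Rightarrow> (nat \<Rightarrow> 'x) measure"
    and p :: "nat \<Rightarrow> real^'k \<Rightarrow> (nat \<Rightarrow> 'x) \<Rightarrow> real"
    and d :: "real^'k \<Rightarrow> real^'k \<Rightarrow> real"
    and \<pi> :: "real^'l \<Rightarrow> real^'k \<Rightarrow> real"
    and \<theta>0 :: "real^'k"
    and I0 :: "real^'k^'k"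
    and theta_hat :: "nat \<Rightarrow> (nat \<Rightarrow> 'x) \<Rightarrow> real^'k"
    and lambda_hat :: "nat \<Rightarrow> (nat \<Rightarrow> 'x) \<Rightarrow> real^'l"
  \<comment> \<open>the parameter space, the model and its densities\<close>
  assumes Theta_polish: "completely_metrizable_space (top_of_set \<Theta>)"
    and P_prob: "\<And>\<theta>. \<theta> \<in> \<Theta> \<Longrightarrow> prob_space (P \<theta>) \<and> sets (P \<theta>) = sets seq_space"
    and nu_sigma_finite: "\<And>n. 1 \<le> n \<Longrightarrow>
          sigma_finite_measure (\<nu> n) \<and> sets (\<nu> n) = sets (sample_space n)"
    and p_nonneg: "\<And>n \<theta> x. 1 \<le> n \<Longrightarrow> \<theta> \<in> \<Theta> \<Longrightarrow> x \<in> space (sample_space n) \<Longrightarrow> 0 \<le> p n \<theta> x"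
    and p_measurable: "\<And>n. 1 \<le> n \<Longrightarrow>
          (\<lambda>(\<theta>, x). p n \<theta> x) \<in> borel_measurable (restrict_space borel \<Theta> \<Otimes>\<^sub>M sample_space n)"
    and p_density: "\<And>n \<theta>. 1 \<le> n \<Longrightarrow> \<theta> \<in> \<Theta> \<Longrightarrow>
          sample_law (P \<theta>) n = density (\<nu> n) (\<lambda>x. ennreal (p n \<theta> x))"
    and theta0: "\<theta>0 \<in> \<Theta>"
    and d_semimetric: "semimetric_on \<Theta> d"
    and d_measurable: "(\<lambda>\<theta>. d \<theta> \<theta>0) \<in> borel_measurable (restrict_space borel \<Theta>)"
    and I0_posdef: "positive_definite I0"
  \<comment> \<open>the priors\<close>
    and pi_nonneg: "\<And>l \<theta>. l \<in> \<Lambda> \<Longrightarrow> \<theta> \<in> \<Theta> \<Longrightarrow> 0 \<le> \<pi> l \<theta>"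
    and pi_measurable: "\<And>l. l \<in> \<Lambda> \<Longrightarrow> \<pi> l \<in> borel_measurable (restrict_space borel \<Theta>)"
    and pi_prob: "\<And>l. l \<in> \<Lambda> \<Longrightarrow> prob_space (prior_of_density \<Theta> (\<pi> l))"
  \<comment> \<open>the estimators and the empirical Bayes posterior\<close>
    and theta_hat_measurable: "\<And>n. 1 \<le> n \<Longrightarrow>
          theta_hat n \<in> measurable (sample_space n) (restrict_space borel \<Theta>)"
    and theta_hat_mle: "AE \<omega> in P \<theta>0. \<forall>\<^sub>F n in sequentially.
          is_mle \<Theta> p n (obs n \<omega>) (theta_hat n (obs n \<omega>))"
    and lambda_hat_measurable: "\<And>n. 1 \<le> n \<Longrightarrow>
          lambda_hat n \<in> measurable (sample_space n) borel"
    and lambda_hat_mmle: "\<And>\<theta>. \<theta> \<in> \<Theta> \<Longrightarrow> AE \<omega> in P \<theta>. \<forall>\<^sub>F n in sequentially.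
          is_mmle \<Lambda> (prior \<Theta> \<Lambda> \<pi>) p n (obs n \<omega>) (lambda_hat n (obs n \<omega>))"
    and mhat_finite: "\<And>\<theta>. \<theta> \<in> \<Theta> \<Longrightarrow> AE \<omega> in P \<theta>. \<forall>\<^sub>F n in sequentially.
          max_marg_lik \<Lambda> (prior \<Theta> \<Lambda> \<pi>) p n (obs n \<omega>) < \<infinity>"
    and EB_well_defined: "\<And>\<theta>. \<theta> \<in> \<Theta> \<Longrightarrow> AE \<omega> in P \<theta>. \<forall>\<^sub>F n in sequentially.
          prob_space (posterior (prior \<Theta> \<Lambda> \<pi> (lambda_hat n (obs n \<omega>))) p n (obs n \<omega>))"
  \<comment> \<open>the hypotheses on the true value\<close>
    and pi_unbounded: "(SUP l\<in>\<Lambda>. ennreal (\<pi> l \<theta>0)) = \<infinity>"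
    and A1: "\<exists>c1>0. \<exists>c2>0. \<exists>t>0. \<forall>\<epsilon>>0. \<forall>n\<ge>1.
          outer_measure_of (P \<theta>0)
            {\<omega> \<in> space (P \<theta>0).
               (SUP \<theta>\<in>\<Theta> - nbhd \<Theta> d \<theta>0 \<epsilon>. lik_ratio p n \<theta>0 \<theta> (obs n \<omega>))
                 \<ge> ennreal (exp (- c1 * real n * \<epsilon>\<^sup>2))}
          \<le> ennreal (c2 * (real n * \<epsilon>\<^sup>2) powr (- (1 + t)))"
    and i: "\<exists>l0\<in>closure \<Lambda>. prior \<Theta> \<Lambda> \<pi> l0 = return (restrict_space borel \<Theta>) \<theta>0"
    and ii: "with_prob_tending_to_1 (sample_law (P \<theta>0))
          (\<lambda>n x. ennreal (p n \<theta>0 x) \<le> max_marg_lik \<Lambda> (prior \<Theta> \<Lambda> \<pi>) p n x)"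
    and iii: "\<And>\<epsilon>. 0 < \<epsilon> \<Longrightarrow> with_prob_tending_to_1 (sample_law (P \<theta>0))
          (\<lambda>n x. \<forall>\<theta>\<in>nbhd \<Theta> d \<theta>0 \<epsilon>.
             let h = \<theta> - theta_hat n x; q = real n * (h \<bullet> (I0 *v h)) / 2 in
             ereal (- q * (1 + \<epsilon>)) \<le> log_lik p n \<theta> x - log_lik p n (theta_hat n x) x \<and>
             log_lik p n \<theta> x - log_lik p n (theta_hat n x) x \<le> ereal (- q * (1 - \<epsilon>)))"
    and iv: "weak_conv_m
          (\<lambda>n. distr (sample_law (P \<theta>0) n) borel
             (\<lambda>x. real_of_ereal (2 * (log_lik p n (theta_hat n x) x - log_lik p n \<theta>0 x))))
          (chi_square CARD('k))"
  shows "\<forall>l\<in>\<Lambda>. 0 < \<pi> l \<theta>0 \<and> continuous (at \<theta>0 within \<Theta>) (\<pi> l) \<longrightarrow>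
          \<not> merge_strongly (P \<theta>0)
              (\<lambda>n \<omega>. posterior (prior \<Theta> \<Lambda> \<pi> (lambda_hat n (obs n \<omega>))) p n (obs n \<omega>))
              (\<lambda>n \<omega>. posterior (prior \<Theta> \<Lambda> \<pi> l) p n (obs n \<omega>))"
proof (intro ballI impI notI)
  fix l
  assume l: "l \<in> \<Lambda>" and l2: "0 < \<pi> l \<theta>0 \<and> continuous (at \<theta>0 within \<Theta>) (\<pi> l)"
    and merge: "merge_strongly (P \<theta>0)
              (\<lambda>n \<omega>. posterior (prior \<Theta> \<Lambda> \<pi> (lambda_hat n (obs n \<omega>))) p n (obs n \<omega>))
              (\<lambda>n \<omega>. posterior (prior \<Theta> \<Lambda> \<pi> l) p n (obs n \<omega>))"

  \<comment> \<open>The two priors and the local prior mass \<open>V\<close>\<close>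
  define N where "N = prior \<Theta> \<Lambda> \<pi> l"
  define E where "E n x = prior \<Theta> \<Lambda> \<pi> (lambda_hat n x)" for n x
  have Neq: "N = prior_of_density \<Theta> (\<pi> l)" unfolding N_def using l by (rule prior_eq_prior_of_density)
  have setsN: "sets N = sets (restrict_space borel \<Theta>)" unfolding N_def by (rule sets_prior)
  interpret N: prob_space N unfolding Neq using l by (rule pi_prob)
  interpret Pr: prob_space "P \<theta>0" using P_prob[OF theta0] by blast
  have setsP[measurable_cong]: "sets (P \<theta>0) = sets seq_space" using P_prob[OF theta0] by blast
  have \<Theta>_borel: "\<Theta> \<in> sets borel" by (rule borel_of_completely_metrizable[OF Theta_polish])
  \<comment> \<open>The value 1/2 serves both as radius in \<open>A1\<close> and as \<epsilon> in
    \<open>iii\<close>. Nothing compares \<open>d\<close> with the Euclidean distance, so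
    \<open>V\<close> measures balls intersected with \<open>U\<close>.\<close>
  define U where "U = nbhd \<Theta> d \<theta>0 (1/2)"
  have U_sets: "U \<in> sets (restrict_space borel \<Theta>)"
  proof -
    have "{\<theta> \<in> space (restrict_space borel \<Theta>). d \<theta> \<theta>0 < 1/2} \<in> sets (restrict_space borel \<Theta>)"
      using d_measurable by measurable
    then show ?thesis by (simp add: U_def nbhd_def space_restrict_space)
  qed
  have U0: "\<theta>0 \<in> U" using theta0 d_semimetric by (auto simp: U_def nbhd_def semimetric_on_def)
  obtain a b where ab: "0 < a" "0 < b" "\<And>v. a * (norm v)\<^sup>2 \<le> v \<bullet> (I0 *v v)" "\<And>v. v \<bullet> (I0 *v v) \<le> b * (norm v)\<^sup>2"
    using positive_definite_bounds[OF I0_posdef] by blast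
  define r0 where "r0 = sqrt (4 * ln 8 / a) + sqrt (2 / a)"
  have r0: "0 < r0" using ab(1) by (auto simp: r0_def intro!: add_nonneg_pos)
  define V where "V r = measure N (U \<inter> cball \<theta>0 r)" for r
  obtain \<delta> C where \<delta>C: "0 < \<delta>" "0 \<le> C" "\<And>r. 0 < r \<Longrightarrow> r \<le> \<delta> \<Longrightarrow> V r \<le> C * r"
    using prior_of_density_ball_linear[OF \<Theta>_borel pi_measurable[OF l] conjunct2[OF l2] U_sets]
    unfolding V_def Neq by blast

  \<comment> \<open>Sample laws and measurability\<close>
  have sl_eq: "sample_law (P \<theta>0) n = distr (P \<theta>0) (sample_space n) (obs n)" for n by (simp add: sample_law_def)
  have sl_sets[measurable_cong]: "sets (sample_law (P \<theta>0) n) = sets (sample_space n)" for n by (simp add: sl_eq)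
  have sl_space: "space (sample_law (P \<theta>0) n) = space (sample_space n)" for n by (simp add: sl_eq)
  have obsP[measurable]: "obs n \<in> measurable (P \<theta>0) (sample_space n)" for n by measurable
  have sl_prob: "prob_space (sample_law (P \<theta>0) n)" for n
    unfolding sl_eq by (intro Pr.prob_space_distr obsP)
  have obs_space: "obs n \<omega> \<in> space (sample_space n)" if "\<omega> \<in> space (P \<theta>0)" for n \<omega>
    using measurable_space[OF obsP that] .

  have sect: "(\<lambda>\<theta>. p n \<theta> x) \<in> borel_measurable (restrict_space borel \<Theta>)" if "1 \<le> n" "x \<in> space (sample_space n)" for n x
    using measurable_compose[OF measurable_Pair2'[OF that(2)] p_measurable[OF that(1)]] by simp
  have p_comp: "(\<lambda>x. p n (h x) x) \<in> borel_measurable (sample_space n)"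
    if "1 \<le> n" "h \<in> measurable (sample_space n) (restrict_space borel \<Theta>)" for n h
    using measurable_compose[OF measurable_Pair[OF that(2) measurable_ident] p_measurable[OF that(1)]] by simp
  have const0: "(\<lambda>_. \<theta>0) \<in> measurable (sample_space n) (restrict_space borel \<Theta>)" for n
    using theta0 by (intro measurable_const) (simp add: space_restrict_space)
  define D where "D n x = real_of_ereal (2 * (log_lik p n (theta_hat n x) x - log_lik p n \<theta>0 x))" for n x
  have D_meas: "D n \<in> borel_measurable (sample_space n)" if "1 \<le> n" for n
  proof -
    have [measurable]: "(\<lambda>x. log_lik p n (theta_hat n x) x) \<in> borel_measurable (sample_space n)"
      "(\<lambda>x. log_lik p n \<theta>0 x) \<in> borel_measurable (sample_space n)"
      using p_comp[OF that theta_hat_measurable[OF that]] p_comp[OF that const0]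
      by (auto intro: log_lik_measurable)
    show ?thesis unfolding D_def by measurable
  qed

  \<comment> \<open>Conditions on the sample and their limiting probabilities\<close>
  define LAN where "LAN n x \<longleftrightarrow> (\<forall>\<theta>\<in>U.
      ereal (- (real n * ((\<theta> - theta_hat n x) \<bullet> (I0 *v (\<theta> - theta_hat n x))) / 2) * (3/2))
        \<le> log_lik p n \<theta> x - log_lik p n (theta_hat n x) x \<and>
      log_lik p n \<theta> x - log_lik p n (theta_hat n x) x
        \<le> ereal (- (real n * ((\<theta> - theta_hat n x) \<bullet> (I0 *v (\<theta> - theta_hat n x))) / 2) * (1/2)))" for n x
  obtain S2 where S2: "\<And>n. S2 n \<in> sets (sample_space n)"
      "\<And>n x. x \<in> S2 n \<Longrightarrow> ennreal (p n \<theta>0 x) \<le> max_marg_lik \<Lambda> (prior \<Theta> \<Lambda> \<pi>) p n x"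
      "(\<lambda>n. measure (sample_law (P \<theta>0) n) (S2 n)) \<longlonglongrightarrow> 1"
    using ii unfolding with_prob_tending_to_1_def sl_sets by blast
  obtain S3 where S3: "\<And>n. S3 n \<in> sets (sample_space n)" "\<And>n x. x \<in> S3 n \<Longrightarrow> LAN n x"
      "(\<lambda>n. measure (sample_law (P \<theta>0) n) (S3 n)) \<longlonglongrightarrow> 1"
  proof -
    have "with_prob_tending_to_1 (sample_law (P \<theta>0)) LAN"
      using iii[of "1/2"] by (simp add: LAN_def[abs_def] U_def Let_def)
    then show thesis using that unfolding with_prob_tending_to_1_def sl_sets by blast
  qed
  \<comment> \<open>\<open>T n\<close> has probability tending to \<open>\<rho>\<close>, the other
    three sets to 1. \<open>Z n\<close> makes the likelihood at the true value nonzero.\<close>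
  define T where "T n = {x\<in>space (sample_space n). D n x \<le> 1}" for n
  define Z where "Z n = {x\<in>space (sample_space n). p n \<theta>0 x \<noteq> 0}" for n
  have T_sets: "T n \<in> sets (sample_space n)" if "1 \<le> n" for n
    unfolding T_def using D_meas[OF that] by measurable
  have Z_sets: "Z n \<in> sets (sample_space n)" if "1 \<le> n" for n
    unfolding Z_def using p_comp[OF that const0] by measurable
  define \<rho> where "\<rho> = cdf (chi_square CARD('k)) 1"
  have \<rho>: "0 < \<rho>" unfolding \<rho>_def by (intro chi_square_cdf) simp
  have T_lim: "(\<lambda>n. measure (sample_law (P \<theta>0) n) (T n)) \<longlonglongrightarrow> \<rho>"
  proof -
    have "(\<lambda>n. cdf (distr (sample_law (P \<theta>0) n) borel (D n)) 1) \<longlonglongrightarrow> \<rho>"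
      using iv chi_square_cdf(1)[of "CARD('k)"]
      unfolding weak_conv_m_def weak_conv_def \<rho>_def D_def[abs_def] by simp
    \<comment> \<open>Measurability of \<open>D n\<close> is known from \<open>n = 1\<close> on, so
      the two sequences are identified only eventually.\<close>
    moreover have "cdf (distr (sample_law (P \<theta>0) n) borel (D n)) 1 = measure (sample_law (P \<theta>0) n) (T n)" if "1 \<le> n" for n
    proof -
      have "D n \<in> borel_measurable (sample_law (P \<theta>0) n)" using D_meas[OF that] by measurable
      then show ?thesis
        by (simp add: cdf_def measure_distr T_def sl_space vimage_def Int_def Collect_conj_eq[symmetric] conj_commute)
    qed
    ultimately show ?thesis
      by (elim Lim_transform_eventually) (use eventually_ge_at_top[of 1] in eventually_elim, auto)
  qed
  have Z_one: "measure (sample_law (P \<theta>0) n) (Z n) = 1" if "1 \<le> n" for n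
  proof -
    interpret Q: prob_space "sample_law (P \<theta>0) n" by (rule sl_prob)
    have nu: "sets (\<nu> n) = sets (sample_space n)" using nu_sigma_finite[OF that] by blast
    have "(\<lambda>x. p n \<theta>0 x) \<in> borel_measurable (\<nu> n)"
      using p_comp[OF that const0] nu by (simp cong: measurable_cong_sets)
    from emeasure_density_zero_set[OF this]
    have "emeasure (sample_law (P \<theta>0) n) {x\<in>space (sample_law (P \<theta>0) n). p n \<theta>0 x = 0} = 0"
      using p_density[OF that theta0] sets_eq_imp_space_eq[OF nu] by (simp add: sl_space)
    then have "measure (sample_law (P \<theta>0) n) {x\<in>space (sample_law (P \<theta>0) n). p n \<theta>0 x = 0} = 0" by (simp add: measure_def)
    moreover have "Z n = space (sample_law (P \<theta>0) n) - {x\<in>space (sample_law (P \<theta>0) n). p n \<theta>0 x = 0}"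
      by (auto simp: Z_def sl_space)
    moreover have "{x\<in>space (sample_law (P \<theta>0) n). p n \<theta>0 x = 0} \<in> sets (sample_law (P \<theta>0) n)"
      using p_comp[OF that const0] by measurable
    ultimately show ?thesis by (simp add: Q.prob_compl)
  qed

  \<comment> \<open>Likelihood ratios away from the true value\<close>
  obtain c1 c2 t where c: "0 < c1" "0 < c2" "0 < t" and A1': "\<And>\<epsilon> n. 0 < \<epsilon> \<Longrightarrow> 1 \<le> n \<Longrightarrow>
      outer_measure_of (P \<theta>0)
            {\<omega> \<in> space (P \<theta>0).
               (SUP \<theta>\<in>\<Theta> - nbhd \<Theta> d \<theta>0 \<epsilon>. lik_ratio p n \<theta>0 \<theta> (obs n \<omega>))
                 \<ge> ennreal (exp (- c1 * real n * \<epsilon>\<^sup>2))}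
          \<le> ennreal (c2 * (real n * \<epsilon>\<^sup>2) powr (- (1 + t)))"
    using A1 by blast
  define bad where "bad n = {\<omega> \<in> space (P \<theta>0).
      (SUP \<theta>\<in>\<Theta> - U. lik_ratio p n \<theta>0 \<theta> (obs n \<omega>)) \<ge> ennreal (exp (- c1 * real n * (1/2)\<^sup>2))}" for n
  \<comment> \<open>The exceptional event may be non-measurable, so it is replaced by a measurable
    cover of the same outer measure.\<close>
  have "\<exists>W. W \<in> sets (P \<theta>0) \<and> bad n \<subseteq> W \<and>
    (1 \<le> n \<longrightarrow> measure (P \<theta>0) W \<le> c2 * (real n * (1/2)\<^sup>2) powr (- (1 + t)))" for n
  proof -
    have bad_space: "bad n \<subseteq> space (P \<theta>0)" unfolding bad_def by (rule Collect_restrict)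
    obtain W where W: "W \<in> sets (P \<theta>0)" "bad n \<subseteq> W" "outer_measure_of (P \<theta>0) (bad n) = emeasure (P \<theta>0) W"
      using outer_measure_of_attain[OF bad_space] by metis
    have "measure (P \<theta>0) W \<le> c2 * (real n * (1/2)\<^sup>2) powr (- (1 + t))" if "1 \<le> n"
    proof -
      have "emeasure (P \<theta>0) W \<le> ennreal (c2 * (real n * (1/2)\<^sup>2) powr (- (1 + t)))"
        using A1'[of "1/2" n] that W(3) by (simp add: bad_def U_def)
      then show ?thesis using c unfolding measure_def by (intro enn2real_leI) auto
    qed
    then show ?thesis using W by blast
  qed
  then obtain W where W: "\<And>n. W n \<in> sets (P \<theta>0)" "\<And>n. bad n \<subseteq> W n"
      "\<And>n. 1 \<le> n \<Longrightarrow> measure (P \<theta>0) (W n) \<le> c2 * (real n * (1/2)\<^sup>2) powr (- (1 + t))"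
    by metis

  \<comment> \<open>A good event with probability bounded away from 0\<close>
  define G where "G n = (obs n -` (S2 n \<inter> S3 n \<inter> T n \<inter> Z n) \<inter> space (P \<theta>0)) - W n" for n
  have G_sets: "G n \<in> sets (P \<theta>0)" if "1 \<le> n" for n
    unfolding G_def using S2(1) S3(1) T_sets[OF that] Z_sets[OF that] W(1)
    by (intro sets.Diff measurable_sets[OF obsP]) auto
  \<comment> \<open>Bonferroni's inequality for four sets subtracts 3; since \<open>Z n\<close> has
    probability 1, subtracting 2 remains.\<close>
  define low where "low n = measure (sample_law (P \<theta>0) n) (S2 n) + measure (sample_law (P \<theta>0) n) (S3 n)
     + measure (sample_law (P \<theta>0) n) (T n) - 2 - c2 * (real n * (1/2)\<^sup>2) powr (- (1 + t))" for n
  have low: "low n \<le> measure (P \<theta>0) (G n)" if "1 \<le> n" for n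
  proof -
    interpret Q: prob_space "sample_law (P \<theta>0) n" by (rule sl_prob)
    note s = S2(1)[of n] S3(1)[of n] T_sets[OF that] Z_sets[OF that]
    have "Q.prob (S2 n) + Q.prob (S3 n) + Q.prob (T n) + Q.prob (Z n) - 3 \<le> Q.prob (S2 n \<inter> S3 n \<inter> T n \<inter> Z n)"
      using Q.prob_Int_ge[of "S2 n" "S3 n"] Q.prob_Int_ge[of "S2 n \<inter> S3 n" "T n"]
        Q.prob_Int_ge[of "S2 n \<inter> S3 n \<inter> T n" "Z n"] s by (simp add: sl_sets)
    also have "\<dots> = measure (P \<theta>0) (obs n -` (S2 n \<inter> S3 n \<inter> T n \<inter> Z n) \<inter> space (P \<theta>0))"
      unfolding sl_eq using s by (intro measure_distr obsP) auto
    also have "\<dots> \<le> measure (P \<theta>0) (G n) + measure (P \<theta>0) (W n)"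
    proof -
      have "measure (P \<theta>0) (obs n -` (S2 n \<inter> S3 n \<inter> T n \<inter> Z n) \<inter> space (P \<theta>0)) \<le> measure (P \<theta>0) (G n \<union> W n)"
        by (intro Pr.finite_measure_mono sets.Un G_sets[OF that] W(1)) (unfold G_def, blast)
      also have "\<dots> \<le> measure (P \<theta>0) (G n) + measure (P \<theta>0) (W n)"
        using G_sets[OF that] W(1) by (intro measure_Un_le) auto
      finally show ?thesis .
    qed
    finally show ?thesis using W(3)[OF that] Z_one[OF that] by (simp add: low_def)
  qed
  have low_lim: "low \<longlonglongrightarrow> \<rho>"
  proof -
    have "(\<lambda>n. c2 * (real n * (1/2)\<^sup>2) powr (- (1 + t))) \<longlonglongrightarrow> 0"
    proof -
      have "filterlim (\<lambda>n. real n * (1/2)\<^sup>2) at_top sequentially"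
        by (rule filterlim_at_top_mult_tendsto_pos[OF tendsto_const _ filterlim_real_sequentially, of "(1/2)\<^sup>2", simplified mult.commute]) simp
      then have "(\<lambda>n. (real n * (1/2)\<^sup>2) powr (- (1 + t))) \<longlonglongrightarrow> 0"
        using c(3) by (intro tendsto_neg_powr) auto
      from tendsto_mult_left[OF this, of c2] show ?thesis by simp
    qed
    then have "(\<lambda>n. measure (sample_law (P \<theta>0) n) (S2 n) + measure (sample_law (P \<theta>0) n) (S3 n)
     + measure (sample_law (P \<theta>0) n) (T n) - 2 - c2 * (real n * (1/2)\<^sup>2) powr (- (1 + t))) \<longlonglongrightarrow> 1 + 1 + \<rho> - 2 - 0"
      by (intro tendsto_intros S2(3) S3(3) T_lim)
    then show ?thesis by (simp add: low_def[abs_def])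
  qed
  have G_ge: "\<forall>\<^sub>F n in sequentially. \<rho> / 2 \<le> measure (P \<theta>0) (G n)"
  proof -
    have "\<forall>\<^sub>F n in sequentially. \<rho> / 2 < low n" using order_tendstoD(1)[OF low_lim, of "\<rho>/2"] \<rho> by simp
    then show ?thesis using eventually_ge_at_top[of 1]
    proof eventually_elim
      case (elim n) then show ?case using low[of n] by linarith
    qed
  qed

  \<comment> \<open>Comparison of the posteriors on the good event\<close>
  have exp_small: "\<forall>\<^sub>F n in sequentially. exp (- c1 * real n * (1/2)\<^sup>2) < 1/4"
  proof -
    have "(\<lambda>n. exp (- (c1 / 4)) ^ n) \<longlonglongrightarrow> 0" using c(1) by (intro LIMSEQ_power_zero) simp
    then have "\<forall>\<^sub>F n in sequentially. exp (- (c1 / 4)) ^ n < 1/4" by (rule order_tendstoD) simp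
    then show ?thesis
      by eventually_elim (simp add: exp_of_nat_mult[symmetric] power2_eq_square field_simps)
  qed

  have "\<forall>\<^sub>F n in sequentially. 0 < V (r0 / sqrt (real n)) \<and> V (R / sqrt (real n)) \<le> 8 * V (r0 / sqrt (real n))"
    if R: "0 < R" for R
  proof -
    define K where "K = exp ((3/2) * (b * (R + sqrt (2/a))\<^sup>2 / 2))"
    \<comment> \<open>\<open>K\<close> does not depend on \<open>n\<close>, so \<eta> is a fixed
      positive number and merging eventually brings the total variation distance below it.\<close>
    define \<eta> where "\<eta> = min (1/4) (1 / K)"
    have K: "0 < K" by (simp add: K_def)
    have \<eta>: "0 < \<eta>" "\<eta> \<le> 1/4" "K * \<eta> \<le> 1" using K by (auto simp: \<eta>_def min_def field_simps)
    define Q where "Q n \<omega> \<longleftrightarrow> is_mmle \<Lambda> (prior \<Theta> \<Lambda> \<pi>) p n (obs n \<omega>) (lambda_hat n (obs n \<omega>))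
       \<and> max_marg_lik \<Lambda> (prior \<Theta> \<Lambda> \<pi>) p n (obs n \<omega>) < \<infinity>
       \<and> prob_space (posterior (E n (obs n \<omega>)) p n (obs n \<omega>))
       \<and> tv_dist (posterior (E n (obs n \<omega>)) p n (obs n \<omega>)) (posterior N p n (obs n \<omega>)) < \<eta>" for n \<omega>
    have "AE \<omega> in P \<theta>0. \<forall>\<^sub>F n in sequentially. Q n \<omega>"
      using lambda_hat_mmle[OF theta0] mhat_finite[OF theta0] EB_well_defined[OF theta0]
        merge[unfolded merge_strongly_def]
    proof eventually_elim
      case (elim \<omega>)
      note elim(1-3)
      moreover have "\<forall>\<^sub>F n in sequentially. tv_dist (posterior (E n (obs n \<omega>)) p n (obs n \<omega>)) (posterior N p n (obs n \<omega>)) < \<eta>"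
        using order_tendstoD(2)[OF elim(4) \<eta>(1)] by (simp add: E_def N_def)
      ultimately show ?case unfolding Q_def E_def
        by (intro eventually_conj)
    qed
    then have "\<forall>\<^sub>F n in sequentially. \<exists>\<omega>\<in>G n. Q n \<omega>"
      using G_ge \<rho> by (intro Pr.eventually_ex_of_AE_eventually[where \<rho> = "\<rho>/2"] G_sets) auto
    then show ?thesis using exp_small eventually_ge_at_top[of 1]
    proof eventually_elim
      case (elim n)
      \<comment> \<open>One outcome suffices: the claim about \<open>V\<close> does not involve the
        sample, so a lower bound \<open>\<rho> / 2\<close> on the probability of \<open>G n\<close>
        is enough.\<close>
      then obtain \<omega> where \<omega>: "\<omega> \<in> G n" "Q n \<omega>" by blast
      define x where "x = obs n \<omega>"
      have \<omega>P: "\<omega> \<in> space (P \<theta>0)" "\<omega> \<notin> bad n" using \<omega>(1) W(2)[of n] by (auto simp: G_def)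
      have x: "x \<in> space (sample_space n)" "x \<in> S2 n" "LAN n x" "D n x \<le> 1" "p n \<theta>0 x \<noteq> 0"
        using \<omega>(1) S3(2) obs_space[OF \<omega>P(1)] by (auto simp: G_def x_def T_def Z_def)
      have p0: "0 < p n \<theta>0 x" using p_nonneg[OF elim(3) theta0 x(1)] x(5) by simp
      have th: "theta_hat n x \<in> \<Theta>"
        using measurable_space[OF theta_hat_measurable[OF elim(3)] x(1)] by (simp add: space_restrict_space)
      have mm: "marg_lik (E n x) p n x = max_marg_lik \<Lambda> (prior \<Theta> \<Lambda> \<pi>) p n x"
        "max_marg_lik \<Lambda> (prior \<Theta> \<Lambda> \<pi>) p n x < \<infinity>"
        using \<omega>(2) by (auto simp: Q_def is_mmle_def E_def x_def)
      have off: "p n \<theta> x \<le> p n \<theta>0 x / 4" if \<theta>: "\<theta> \<in> \<Theta> - U" for \<theta>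
      proof -
        have "(SUP \<theta>\<in>\<Theta> - U. lik_ratio p n \<theta>0 \<theta> x) < ennreal (exp (- c1 * real n * (1/2)\<^sup>2))"
          using \<omega>P by (simp add: bad_def x_def not_le)
        then have "lik_ratio p n \<theta>0 \<theta> x < ennreal (exp (- c1 * real n * (1/2)\<^sup>2))"
          using \<theta> by (meson SUP_upper le_less_trans)
        then have "ennreal (p n \<theta> x / p n \<theta>0 x) < ennreal (exp (- c1 * real n * (1/2)\<^sup>2))"
          using p_nonneg[OF elim(3) _ x(1), of \<theta>] \<theta> p0 by (simp add: lik_ratio_def divide_ennreal)
        then have "p n \<theta> x / p n \<theta>0 x < exp (- c1 * real n * (1/2)\<^sup>2)"
          by (subst (asm) ennreal_less_iff) (use p_nonneg[OF elim(3) _ x(1), of \<theta>] \<theta> p0 in auto)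
        then have "p n \<theta> x / p n \<theta>0 x < 1/4" using elim(2) by linarith
        then show ?thesis using p0 by (simp add: field_simps)
      qed
      have fin: "marg_lik N p n x < \<infinity>"
        using l mm(2) unfolding N_def max_marg_lik_def by (meson SUP_upper le_less_trans)
      note loc = posterior_local_mass[where p = p and n = n and x = x and M = "E n x" and N = N and \<Theta> = \<Theta>
          and U = U and ?t0.0 = \<theta>0 and t = "theta_hat n x" and A = I0 and a = a and b = b and R = R
          and \<eta> = \<eta> and ?r0.0 = r0,
          OF _ setsN _ N.prob_space_axioms sect[OF elim(3) x(1)] p_nonneg[OF elim(3) _ x(1)] _ p0 _ fin
            _ U_sets U0 th elim(3) off _ x(4)[unfolded D_def] ab R]
      have 1: "sets (E n x) = sets (restrict_space borel \<Theta>)" unfolding E_def by (rule sets_prior)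
      have 2: "emeasure (E n x) (space (E n x)) \<le> 1" unfolding E_def by (intro emeasure_prior_le_1 pi_prob)
      have 3: "prob_space (posterior (E n x) p n x)"
        "tv_dist (posterior (E n x) p n x) (posterior N p n x) \<le> \<eta>"
        using \<omega>(2) by (auto simp: Q_def x_def)
      \<comment> \<open>Here \<open>ii\<close> enters: at \<open>lambda_hat\<close> the marginal
        likelihood attains the supremum, which on \<open>S2 n\<close> dominates the likelihood at
        the true value.\<close>
      have 4: "ennreal (p n \<theta>0 x) \<le> marg_lik (E n x) p n x" using S2(2)[OF x(2)] mm(1) by simp
      show ?case unfolding V_def
        using 1 2 3 4 \<eta> x(3) by (intro conjI loc) (auto simp: LAN_def K_def r0_def)
    qed
  qed
  then show False using no_uniform_scaling[where V = V and K = 8, OF \<delta>C r0] by simp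
qed

end
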